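(* Let $(f,\nu)$ be a standard scheme on the countable set $\mathcal{D}$ and let $\mathbf{u}=\{u_I\}_{I\in\mathcal{D}}$ be a weight sequence. Fix $\xi>0$ and $\mu\in(0,\infty]$. Then, for any function $\eta\in\mathbb{W}_+$, the following are equivalent: 1) There exists $C>0$ such that for all $\Gamma\subset\mathcal{D}$ with $\nu(\Gamma)<\infty$, $$\Big\|\sum_{I\in\Gamma}\frac{\mathbf{e}_I}{u_I}\Big\|_f\le C\,\eta(\nu(\Gamma)).$$ 2) $\ell^\mu_{\xi,\eta}(\mathbf{u},\nu)\hookrightarrow\mathcal{A}^\xi_\mu(f,\nu)$ (continuous inclusion). 3) The space $\ell^\mu_{\xi,\eta}(\mathbf{u},\nu)$ satisfies Jackson's inequality of order $\xi$, that is, there exists $C>0$ such that $$\sigma_\nu(t,\mathbf{s})_f\le C\,t^{-\xi}\,\|\mathbf{s}\|_{\ell^\mu_{\xi,\eta}(\mathbf{u},\nu)}\quad\text{for all }\mathbf{s}\in\ell^\mu_{\xi,\eta}(\mathbf{u},\nu)\text{ and all } t>0.$$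
   Context: $\mathcal{D}$ is a countable index set, $S=\mathbb{C}^{\mathcal{D}}$ is the set of all complex sequences $\mathbf{s}=\{s_I\}_{I\in\mathcal{D}}$, and $\mathbf{e}_I\in S$ has entry $1$ at $I$ and $0$ elsewhere. For $\Gamma\subset\mathcal{D}$ (possibly infinite), $\sum_{I\in\Gamma}s_I\mathbf{e}_I$ denotes the element of $S$ whose entry is $s_I$ for $I\in\Gamma$ and $0$ otherwise (no convergence is meant). A quasi-Banach (sequence) lattice is a linear space $f\subset S$ with a quasi-norm $\|\cdot\|_f$ for which $f$ is complete and such that: (a) if $\mathbf{t}\in f$ and $|s_I|\le|t_I|$ for all $I$, then $\mathbf{s}\in f$ and $\|\mathbf{s}\|_f\le\|\mathbf{t}\|_f$; (b) if $\mathbf{s}\in f$, then $\lim_{n\to\infty}\|s_{I_n}\mathbf{e}_{I_n}\|_f=0$ for some enumeration $\{I_1,I_2,\dots\}$ of $\mathcal{D}$. It is embedded in $S$ if $\|\mathbf{s}^{n}-\mathbf{s}\|_f\to0$ implies $s^{(n)}_I\to s_I$ for all $I\in\mathcal{D}$. Convention: $\|\mathbf{s}\|_f=\infty$ if $\mathbf{s}\in S\setminus f$. A standard scheme $(f,\nu)$ consists of a quasi-Banach lattice $f$ embedded in $S$ and a positive measure $\nu$ on $\mathcal{D}$ with $\nu(I)>0$ for all $I\in\mathcal{D}$. A weight sequence is a sequence $\mathbf{u}=\{u_I\}_{I\in\mathcal{D}}$ with $u_I>0$ for all $I$. For $t>0$, $\Sigma_{t,\nu}=\{\sum_{I\in\Gamma}t_I\mathbf{e}_I:\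 \Gamma\subset\mathcal{D},\ \nu(\Gamma)\le t\}$, and for $\mathbf{s}\in S$, $\sigma_\nu(t,\mathbf{s})=\sigma_\nu(t,\mathbf{s})_f=\inf_{\mathbf{t}\in\Sigma_{t,\nu}}\|\mathbf{s}-\mathbf{t}\|_f$. The restricted approximation space $\mathcal{A}^\xi_\mu(f,\nu)$ ($0<\xi<\infty$, $0<\mu\le\infty$) is the set of $\mathbf{s}\in S$ with $\|\mathbf{s}\|_{\mathcal{A}^\xi_\mu(f,\nu)}=\big(\int_0^\infty[t^\xi\sigma_\nu(t,\mathbf{s})]^\mu\frac{dt}{t}\big)^{1/\mu}<\infty$ if $\mu<\infty$, and $\|\mathbf{s}\|_{\mathcal{A}^\xi_\infty(f,\nu)}=\sup_{t>0}t^\xi\sigma_\nu(t,\mathbf{s})<\infty$ if $\mu=\infty$. $\mathbb{W}$ is the set of continuous non-decreasing $\eta:[0,\infty)\to[0,\infty)$ with $\eta(0)=0$, $\lim_{t\to\infty}\eta(t)=\infty$, and $\eta(2t)\le C\eta(t)$ for all $t>0$ and some $C>0$. For $\eta\in\mathbb{W}$, $M_\eta(s)=\sup_{t>0}\eta(st)/\eta(t)$, $s>0$. $\mathbb{W}_+$ is the set of $\eta\in\mathbb{W}$ for which there is $s_0\in(0,1)$ with $M_\eta(s_0)<1$. For $\mathbf{s}\in S$, $\mathbf{s}^\ast_\nu(t)=\inf\{\lambda>0:\nu(\{I:|s_I|>\lambda\})\le t\}$. For $\eta\in\mathbb{W}$, $\ell^\mu_\eta(\nu)$ is the set of $\mathbf{s}\in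 S$ with $\|\mathbf{s}\|_{\ell^\mu_\eta(\nu)}=\big(\int_0^\infty[\eta(t)\mathbf{s}^\ast_\nu(t)]^\mu\frac{dt}{t}\big)^{1/\mu}<\infty$ (for $\mu=\infty$: $\sup_{t>0}\eta(t)\mathbf{s}^\ast_\nu(t)<\infty$). $\ell^\mu_\eta(\mathbf{u},\nu)$ is the set of $\mathbf{s}\in S$ with $\|\mathbf{s}\|_{\ell^\mu_\eta(\mathbf{u},\nu)}=\|\{u_Is_I\}_{I}\|_{\ell^\mu_\eta(\nu)}<\infty$. For $\xi>0$, $\ell^\mu_{\xi,\eta}(\mathbf{u},\nu)$ denotes $\ell^\mu_{\tilde\eta}(\mathbf{u},\nu)$ with $\tilde\eta(t)=t^\xi\eta(t)$. *)

theory Defs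
  imports "HOL-Analysis.Analysis"
begin

text \<open>
  The countable index set is a type \<^typ>\<open>'i\<close> of class \<^class>\<open>countable\<close>, and a complex
  sequence is a function \<^typ>\<open>'i \<Rightarrow> complex\<close>.
\<close>

definition restr :: "'i set \<Rightarrow> ('i \<Rightarrow> complex) \<Rightarrow> 'i \<Rightarrow> complex" where
  "restr \<Gamma> s = (\<lambda>I. if I \<in> \<Gamma> then s I else 0)"

text \<open>
  The last assumption speaks of an enumeration of the index set. If the index set is finite, an
  enumeration is a finite list and there is no limit to be taken, so nothing is required then.
\<close>

locale quasi_banach_lattice =
  fixes F :: "('i::countable \<Rightarrow> complex) set"
    and nF :: "('i \<Rightarrow> complex) \<Rightarrow> real"
  assumes zero_mem: "(\<lambda>I. 0) \<in> F"
    and add_mem: "\<And>s t. s \<in> F \<Longrightarrow> t \<in> F \<Longrightarrow> (\<lambda>I. s I + t I) \<in> F"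
    and scale_mem: "\<And>c s. s \<in> F \<Longrightarrow> (\<lambda>I. c * s I) \<in> F"
    and norm_nonneg: "\<And>s. s \<in> F \<Longrightarrow> 0 \<le> nF s"
    and norm_eq_zero: "\<And>s. s \<in> F \<Longrightarrow> nF s = 0 \<longleftrightarrow> s = (\<lambda>I. 0)"
    and norm_scale: "\<And>c s. s \<in> F \<Longrightarrow> nF (\<lambda>I. c * s I) = cmod c * nF s"
    and quasi_triangle:
      "\<exists>K\<ge>1. \<forall>s\<in>F. \<forall>t\<in>F. nF (\<lambda>I. s I + t I) \<le> K * (nF s + nF t)"
    and complete:
      "\<And>x :: nat \<Rightarrow> 'i \<Rightarrow> complex. \<lbrakk>\<And>n. x n \<in> F;
          \<And>e. e > 0 \<Longrightarrow> \<exists>N. \<forall>m\<ge>N. \<forall>n\<ge>N. nF (\<lambda>I. x m I - x n I) < e\<rbrakk>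
        \<Longrightarrow> \<exists>s\<in>F. (\<lambda>n. nF (\<lambda>I. x n I - s I)) \<longlonglongrightarrow> 0"
    and solid_mem: "\<And>s t. t \<in> F \<Longrightarrow> (\<And>I. cmod (s I) \<le> cmod (t I)) \<Longrightarrow> s \<in> F"
    and norm_mono: "\<And>s t. t \<in> F \<Longrightarrow> (\<And>I. cmod (s I) \<le> cmod (t I)) \<Longrightarrow> nF s \<le> nF t"
    and coords_vanish:
      "\<And>s. infinite (UNIV :: 'i set) \<Longrightarrow> s \<in> F \<Longrightarrow>
        \<exists>e :: nat \<Rightarrow> 'i. bij e \<and> (\<lambda>n. nF (restr {e n} s)) \<longlonglongrightarrow> 0"

definition embedded_in_S ::
    "('i \<Rightarrow> complex) set \<Rightarrow> (('i \<Rightarrow> complex) \<Rightarrow> real) \<Rightarrow> bool" where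
  "embedded_in_S F nF \<longleftrightarrow>
    (\<forall>(x :: nat \<Rightarrow> 'i \<Rightarrow> complex) s.
      (\<forall>n. x n \<in> F) \<and> s \<in> F \<and> (\<lambda>n. nF (\<lambda>I. x n I - s I)) \<longlonglongrightarrow> 0
      \<longrightarrow> (\<forall>I. (\<lambda>n. x n I) \<longlonglongrightarrow> s I))"

text \<open>
  Points may have infinite measure, and \<^term>\<open>\<nu>\<close> need not be sigma-finite.
\<close>

locale standard_scheme = quasi_banach_lattice F nF
  for F :: "('i::countable \<Rightarrow> complex) set" and nF +
  fixes \<nu> :: "'i measure"
  assumes embedded: "embedded_in_S F nF"
    and sets_nu: "sets \<nu> = UNIV"
    and nu_pos: "\<And>I. 0 < emeasure \<nu> {I}"

text \<open>The convention that the quasi-norm is infinite off \<^term>\<open>F\<close>.\<close>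

definition ext_norm ::
    "('i \<Rightarrow> complex) set \<Rightarrow> (('i \<Rightarrow> complex) \<Rightarrow> real) \<Rightarrow> ('i \<Rightarrow> complex) \<Rightarrow> ennreal" where
  "ext_norm F nF s = (if s \<in> F then ennreal (nF s) else \<infinity>)"

definition Sigma_set :: "'i measure \<Rightarrow> real \<Rightarrow> ('i \<Rightarrow> complex) set" where
  "Sigma_set \<nu> t = {restr \<Gamma> s | \<Gamma> s. emeasure \<nu> \<Gamma> \<le> ennreal t}"

definition approx_err ::
    "('i \<Rightarrow> complex) set \<Rightarrow> (('i \<Rightarrow> complex) \<Rightarrow> real) \<Rightarrow> 'i measure \<Rightarrow> real \<Rightarrow>
      ('i \<Rightarrow> complex) \<Rightarrow> ennreal" where
  "approx_err F nF \<nu> t s = (INF y\<in>Sigma_set \<nu> t. ext_norm F nF (\<lambda>I. s I - y I))"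

text \<open>Powers of extended nonnegative reals, used only with a positive exponent.\<close>

definition ennpow :: "ennreal \<Rightarrow> real \<Rightarrow> ennreal" where
  "ennpow x p = (if x = \<infinity> then \<infinity> else ennreal (enn2real x powr p))"

text \<open>
  The quasi-norm of \<^term>\<open>g\<close> in \<open>L\<^sup>\<mu>((0,\<infinity>), dt/t)\<close>. It is applied only to functions of the form
  \<open>t \<mapsto> h t * g t\<close> with \<open>h\<close> continuous on \<open>(0,\<infinity>)\<close> and \<open>g\<close> non-increasing. For these the
  essential supremum and the supremum over \<open>t > 0\<close> agree, and the integrand is measurable.
\<close>

definition Lmu_norm :: "ennreal \<Rightarrow> (real \<Rightarrow> ennreal) \<Rightarrow> ennreal" where
  "Lmu_norm \<mu> g =
    (if \<mu> = \<infinity> then (SUP t\<in>{0<..}. g t)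
     else ennpow (\<integral>\<^sup>+ t\<in>{0<..}. ennpow (g t) (enn2real \<mu>) * ennreal (1 / t) \<partial>lborel)
            (1 / enn2real \<mu>))"

definition A_norm ::
    "('i \<Rightarrow> complex) set \<Rightarrow> (('i \<Rightarrow> complex) \<Rightarrow> real) \<Rightarrow> 'i measure \<Rightarrow> real \<Rightarrow> ennreal \<Rightarrow>
      ('i \<Rightarrow> complex) \<Rightarrow> ennreal" where
  "A_norm F nF \<nu> \<xi> \<mu> s = Lmu_norm \<mu> (\<lambda>t. ennreal (t powr \<xi>) * approx_err F nF \<nu> t s)"

definition A_space ::
    "('i \<Rightarrow> complex) set \<Rightarrow> (('i \<Rightarrow> complex) \<Rightarrow> real) \<Rightarrow> 'i measure \<Rightarrow> real \<Rightarrow> ennreal \<Rightarrow>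
      ('i \<Rightarrow> complex) set" where
  "A_space F nF \<nu> \<xi> \<mu> = {s. A_norm F nF \<nu> \<xi> \<mu> s < \<infinity>}"

text \<open>Functions on \<open>[0,\<infinity>)\<close> are total functions on the reals whose values at negative
  arguments are irrelevant.\<close>

definition W_class :: "(real \<Rightarrow> real) set" where
  "W_class = {\<eta>. \<eta> \<in> {0..} \<rightarrow> {0..} \<and> continuous_on {0..} \<eta> \<and> mono_on {0..} \<eta> \<and> \<eta> 0 = 0 \<and>
     filterlim \<eta> at_top at_top \<and> (\<exists>C>0. \<forall>t>0. \<eta> (2 * t) \<le> C * \<eta> t)}"

definition M_fun :: "(real \<Rightarrow> real) \<Rightarrow> real \<Rightarrow> ennreal" where
  "M_fun \<eta> s = (SUP t\<in>{0<..}. ennreal (\<eta> (s * t) / \<eta> t))"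

definition W_plus :: "(real \<Rightarrow> real) set" where
  "W_plus = {\<eta> \<in> W_class. \<exists>s0. 0 < s0 \<and> s0 < 1 \<and> M_fun \<eta> s0 < 1}"

text \<open>The non-increasing rearrangement. It is infinite where no \<open>\<lambda>\<close> is admissible.\<close>

definition rearr :: "'i measure \<Rightarrow> ('i \<Rightarrow> complex) \<Rightarrow> real \<Rightarrow> ennreal" where
  "rearr \<nu> s t =
    (INF l\<in>{l::real. 0 < l \<and> emeasure \<nu> {I. cmod (s I) > l} \<le> ennreal t}. ennreal l)"

definition l_norm ::
    "'i measure \<Rightarrow> ennreal \<Rightarrow> (real \<Rightarrow> real) \<Rightarrow> ('i \<Rightarrow> complex) \<Rightarrow> ennreal" where
  "l_norm \<nu> \<mu> \<eta> s = Lmu_norm \<mu> (\<lambda>t. ennreal (\<eta> t) * rearr \<nu> s t)"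

definition lw_norm ::
    "('i \<Rightarrow> real) \<Rightarrow> 'i measure \<Rightarrow> ennreal \<Rightarrow> (real \<Rightarrow> real) \<Rightarrow> ('i \<Rightarrow> complex) \<Rightarrow> ennreal" where
  "lw_norm u \<nu> \<mu> \<eta> s = l_norm \<nu> \<mu> \<eta> (\<lambda>I. of_real (u I) * s I)"

definition lxi_norm ::
    "('i \<Rightarrow> real) \<Rightarrow> 'i measure \<Rightarrow> ennreal \<Rightarrow> real \<Rightarrow> (real \<Rightarrow> real) \<Rightarrow> ('i \<Rightarrow> complex) \<Rightarrow> ennreal"
  where
  "lxi_norm u \<nu> \<mu> \<xi> \<eta> = lw_norm u \<nu> \<mu> (\<lambda>t. t powr \<xi> * \<eta> t)"

definition lxi_space ::
    "('i \<Rightarrow> real) \<Rightarrow> 'i measure \<Rightarrow> ennreal \<Rightarrow> real \<Rightarrow> (real \<Rightarrow> real) \<Rightarrow> ('i \<Rightarrow> complex) set" where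
  "lxi_space u \<nu> \<mu> \<xi> \<eta> = {s. lxi_norm u \<nu> \<mu> \<xi> \<eta> s < \<infinity>}"

definition cont_incl ::
    "'a set \<Rightarrow> ('a \<Rightarrow> ennreal) \<Rightarrow> 'a set \<Rightarrow> ('a \<Rightarrow> ennreal) \<Rightarrow> bool" where
  "cont_incl X nX Y nY \<longleftrightarrow> X \<subseteq> Y \<and> (\<exists>C::real. C > 0 \<and> (\<forall>s\<in>X. nY s \<le> ennreal C * nX s))"

definition jackson ::
    "('i \<Rightarrow> complex) set \<Rightarrow> (('i \<Rightarrow> complex) \<Rightarrow> real) \<Rightarrow> 'i measure \<Rightarrow> real \<Rightarrow>
      ('i \<Rightarrow> complex) set \<Rightarrow> (('i \<Rightarrow> complex) \<Rightarrow> ennreal) \<Rightarrow> bool" where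
  "jackson F nF \<nu> \<xi> X nX \<longleftrightarrow>
    (\<exists>C::real. C > 0 \<and>
      (\<forall>s\<in>X. \<forall>t>0. approx_err F nF \<nu> t s \<le> ennreal (C * t powr (- \<xi>)) * nX s))"

end

theory Submission
  imports Defs
begin

text \<open>
  A series whose terms have quasi-norms decaying like \<open>(2K)\<^sup>-\<^sup>k\<close>, with \<open>K\<close> the constant of the
  quasi-triangle inequality, converges without renorming. To pass from 1) to 2), cut an element at
  the values of its rearrangement at \<open>R\<^sup>k t\<close>; for \<open>R\<close> large the level sets form such a series, and
  \<open>t\<^sup>\<xi> \<sigma>(t, s)\<close> is bounded by a multiple of \<open>sup\<^sub>k q\<^sup>k g(R\<^sup>k t)\<close> with \<open>q < 1\<close>, where \<open>g\<close> is the
  function whose \<open>L\<^sup>\<mu>(dt/t)\<close> norm is the norm of the element. Bounding the supremum of the \<open>\<mu>\<close>-th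
  powers by their sum and using dilation invariance of \<open>dt/t\<close> gives the inclusion for all \<open>\<mu>\<close> at
  once. From 2) to 3), integrate over \<open>[t/2, t]\<close>. From 3) to 1), Jackson's inequality at
  \<open>t = \<delta> \<nu>(\<Gamma>)\<close> removes from \<open>\<Gamma>\<close> all but a part of measure at most \<open>\<delta> \<nu>(\<Gamma>)\<close>; iterating exhausts \<open>\<Gamma>\<close>
  because every point has positive measure, and \<open>\<eta>(\<delta> x) \<le> \<eta>(x) / (2K)\<close> makes the removed parts
  summable.
\<close>

section \<open>Powers of extended nonnegative reals\<close>

lemma ennpow_ennreal: "0 \<le> x \<Longrightarrow> ennpow (ennreal x) p = ennreal (x powr p)"
  by (simp add: ennpow_def)

lemma ennpow_top: "ennpow top p = top"
  by (simp add: ennpow_def)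

lemma ennpow_mono:
  assumes "x \<le> y" "0 \<le> p"
  shows "ennpow x p \<le> ennpow y p"
proof (cases "y = \<infinity>")
  case False
  then have "y < top" by (simp add: less_top)
  with assms have "x < top" by simp
  with assms \<open>y < top\<close> show ?thesis
    by (auto simp: ennpow_def intro!: ennreal_leI powr_mono2 enn2real_mono)
qed (simp add: ennpow_top)

lemma ennpow_mult:
  assumes "0 < p"
  shows "ennpow (x * y) p = ennpow x p * ennpow y p"
proof (cases x; cases y)
  fix a b assume "x = ennreal a" "0 \<le> a" "y = ennreal b" "0 \<le> b"
  then show ?thesis
    by (simp add: ennpow_ennreal powr_mult flip: ennreal_mult)
next
  fix a assume "x = ennreal a" "0 \<le> a" "y = top"
  then show ?thesis
    by (cases "a = 0") (auto simp: ennpow_def ennreal_mult_top)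
next
  fix b assume "x = top" "y = ennreal b" "0 \<le> b"
  then show ?thesis
    by (cases "b = 0") (auto simp: ennpow_def ennreal_top_mult)
qed (simp add: ennpow_def)

lemma ennpow_ennpow_inverse:
  assumes "0 < p"
  shows "ennpow (ennpow x p) (1 / p) = x" "ennpow (ennpow x (1 / p)) p = x"
  using assms by (cases x; simp add: ennpow_ennreal powr_powr ennpow_top)+

text \<open>Each \<open>y k\<close> lies below the p-th root of the sum, hence so does the supremum;
  raising to the power p again gives the claim without moving the power through the
  supremum.\<close>

lemma ennpow_SUP_le_suminf:
  fixes y :: "nat \<Rightarrow> ennreal"
  assumes "0 < p"
  shows "ennpow (SUP k. y k) p \<le> (\<Sum>k. ennpow (y k) p)"
proof -
  have "y k \<le> ennpow (\<Sum>k. ennpow (y k) p) (1 / p)" for k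
  proof -
    have "ennpow (y k) p \<le> (\<Sum>k. ennpow (y k) p)"
      using sum_le_suminf[of "\<lambda>k. ennpow (y k) p" "{k}"] by simp
    from ennpow_mono[OF this, of "1 / p"] show ?thesis
      using assms by (simp add: ennpow_ennpow_inverse)
  qed
  then have "(SUP k. y k) \<le> ennpow (\<Sum>k. ennpow (y k) p) (1 / p)"
    by (rule SUP_least)
  from ennpow_mono[OF this, of p] show ?thesis
    using assms by (simp add: ennpow_ennpow_inverse)
qed

lemma borel_measurable_ennpow [measurable]: "(\<lambda>x. ennpow x p) \<in> borel_measurable borel"
  unfolding ennpow_def by measurable

section \<open>The quasi-norm with respect to dt/t\<close>

lemma antimono_borel_measurable_ennreal:
  fixes f :: "real \<Rightarrow> ennreal"
  assumes "antimono f"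
  shows "f \<in> borel_measurable borel"
proof (rule borel_measurableI_greater)
  fix y
  have "is_interval {x. y < f x}"
    unfolding is_interval_1 using assms by (auto dest: antimonoD intro: less_le_trans)
  then show "{x \<in> space borel. y < f x} \<in> sets borel"
    by (simp add: real_interval_borel_measurable)
qed

text \<open>On [t/2, t] the density 1/x is at least 1/t, so this interval has dt/t-measure at least
  1/2; the factor 2 enters with exponent 1/\<mu>. For \<mu> = \<infinity> both
  \<open>enn2real \<mu>\<close> and its inverse are 0, and the factor is 1.\<close>

lemma Lmu_norm_ge_const:
  assumes "0 < \<mu>" "0 < t" and le: "\<And>x. t / 2 \<le> x \<Longrightarrow> x \<le> t \<Longrightarrow> a \<le> g x"
  shows "a \<le> ennreal (2 powr (1 / enn2real \<mu>)) * Lmu_norm \<mu> g"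
proof (cases "\<mu> = \<infinity>")
  case True
  have "a \<le> g t" using assms by simp
  also have "\<dots> \<le> Lmu_norm \<mu> g"
    using True assms by (auto simp: Lmu_norm_def intro: SUP_upper)
  finally show ?thesis using True by simp
next
  case False
  define p where "p = enn2real \<mu>"
  have p: "0 < p" using False assms by (simp add: p_def enn2real_positive_iff less_top)
  define J where "J = (\<integral>\<^sup>+ x\<in>{0<..}. ennpow (g x) p * ennreal (1 / x) \<partial>lborel)"
  have "ennpow a p * ennreal (1 / 2) = (\<integral>\<^sup>+ x. (ennpow a p * ennreal (1 / t)) * indicator {t/2..t} x \<partial>lborel)"
    using assms by (subst nn_integral_cmult_indicator) (auto simp: mult.assoc simp flip: ennreal_mult)
  also have "\<dots> \<le> J" unfolding J_def
  proof (rule nn_integral_mono)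
    fix x :: real
    show "(ennpow a p * ennreal (1 / t)) * indicator {t/2..t} x
      \<le> ennpow (g x) p * ennreal (1 / x) * indicator {0<..} x"
    proof (cases "x \<in> {t/2..t}")
      case True
      then have "ennpow a p * ennreal (1 / t) \<le> ennpow (g x) p * ennreal (1 / x)"
        using assms p by (intro mult_mono ennpow_mono ennreal_leI) (auto simp: divide_simps)
      then show ?thesis using True assms by simp
    qed simp
  qed
  finally have "ennreal 2 * (ennpow a p * ennreal (1 / 2)) \<le> ennreal 2 * J"
    by (rule mult_left_mono) simp
  moreover have "ennreal 2 * (ennpow a p * ennreal (1 / 2)) = ennpow a p * (ennreal 2 * ennreal (1/2))"
    by (simp only: ac_simps)
  moreover have "ennreal 2 * ennreal (1/2) = 1"
    by (subst ennreal_mult[symmetric]) auto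
  ultimately have "ennpow a p \<le> ennreal 2 * J" by simp
  from ennpow_mono[OF this, of "1 / p"] have "a \<le> ennpow (ennreal 2) (1 / p) * ennpow J (1 / p)"
    using p by (simp add: ennpow_ennpow_inverse ennpow_mult)
  then show ?thesis
    using False by (simp add: Lmu_norm_def J_def p_def ennpow_ennreal del: ennreal_numeral)
qed

text \<open>This is the substitution x = R t. Measurability is asked for on the positive half-line
  only, because the functions of interest contain \<eta>, whose values at negative arguments are
  arbitrary.\<close>

lemma nn_integral_dilation_invariant:
  fixes g :: "real \<Rightarrow> ennreal"
  assumes "0 < R" and meas: "(\<lambda>x. g x * indicator {0<..} x) \<in> borel_measurable borel"
  shows "(\<integral>\<^sup>+ t\<in>{0<..}. g (R * t) * ennreal (1 / t) \<partial>lborel) =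
    (\<integral>\<^sup>+ t\<in>{0<..}. g t * ennreal (1 / t) \<partial>lborel)"
proof -
  define f where "f x = (g x * indicator {0<..} x) * ennreal (1 / x)" for x :: real
  have f: "f \<in> borel_measurable borel"
    unfolding f_def using meas by measurable
  have fr: "f x = g x * ennreal (1 / x) * indicator {0<..} x" for x
    by (simp add: f_def ac_simps)
  have "(\<integral>\<^sup>+ t. f t \<partial>lborel) = ennreal \<bar>R\<bar> * (\<integral>\<^sup>+ t. f (0 + R * t) \<partial>lborel)"
    by (rule nn_integral_real_affine) (use f assms in auto)
  also have "\<dots> = (\<integral>\<^sup>+ t. ennreal R * f (R * t) \<partial>lborel)"
    using f assms by (subst nn_integral_cmult) auto
  also have "\<dots> = (\<integral>\<^sup>+ t\<in>{0<..}. g (R * t) * ennreal (1 / t) \<partial>lborel)"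
  proof (rule nn_integral_cong)
    fix t :: real
    show "ennreal R * f (R * t) = g (R * t) * ennreal (1 / t) * indicator {0<..} t"
    proof (cases "t > 0")
      case True
      have "ennreal R * ennreal (1 / (R * t)) = ennreal (1 / t)"
        using assms True by (subst ennreal_mult[symmetric]) auto
      moreover have "ennreal R * (g (R * t) * ennreal (1 / (R * t))) =
          g (R * t) * (ennreal R * ennreal (1 / (R * t)))"
        by (simp only: ac_simps)
      ultimately show ?thesis using True assms by (simp add: fr)
    qed (use assms in \<open>auto simp: fr zero_less_mult_iff\<close>)
  qed
  finally show ?thesis by (simp add: fr)
qed

text \<open>For finite \<mu> the supremum is replaced by a sum before integrating: the power p of
  the supremum is at most the sum of the powers, every dilate contributes the same integral
  \<open>J\<close>, and the ratio \<open>q powr p\<close> < 1 makes the sum geometric. No triangle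
  inequality for the integral norm enters, so \<mu> < 1 needs no separate treatment.\<close>

lemma Lmu_norm_SUP_dilations:
  fixes g h :: "real \<Rightarrow> ennreal" and \<mu> :: ennreal
  defines "p \<equiv> enn2real \<mu>"
  assumes "0 < \<mu>" "0 < q" "q < 1" "0 < R" "0 < A"
    and meas: "(\<lambda>x. g x * indicator {0<..} x) \<in> borel_measurable borel"
    and h: "\<And>t. 0 < t \<Longrightarrow> h t \<le> ennreal A * (SUP k. ennreal (q ^ k) * g (R ^ k * t))"
  shows "Lmu_norm \<mu> h \<le> ennreal ((1 + (1 / (1 - q powr p)) powr (1 / p)) * A) * Lmu_norm \<mu> g"
proof (cases "\<mu> = \<infinity>")
  case True
  have "h t \<le> ennreal (1 * A) * Lmu_norm \<mu> g" if "0 < t" for t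
  proof -
    have "ennreal (q ^ k) * g (R ^ k * t) \<le> 1 * Lmu_norm \<mu> g" for k
    proof (rule mult_mono)
      show "ennreal (q ^ k) \<le> 1"
        using assms by (simp add: power_le_one)
      show "g (R ^ k * t) \<le> Lmu_norm \<mu> g"
        using True assms that by (auto simp: Lmu_norm_def intro: SUP_upper)
    qed auto
    then have "(SUP k. ennreal (q ^ k) * g (R ^ k * t)) \<le> Lmu_norm \<mu> g"
      by (intro SUP_least) simp
    then show ?thesis
      using order_trans[OF h[OF that] mult_left_mono] by simp
  qed
  then have "Lmu_norm \<mu> h \<le> ennreal (1 * A) * Lmu_norm \<mu> g"
    using True by (subst Lmu_norm_def) (auto intro: SUP_least)
  \<comment> \<open>For \<open>\<mu> = \<infinity>\<close> we have \<open>p = 0\<close> and the power is the junk value \<open>0\<close>, hence the summand \<open>1\<close>.\<close>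
  also have "\<dots> \<le> ennreal ((1 + (1 / (1 - q powr p)) powr (1 / p)) * A) * Lmu_norm \<mu> g"
    using \<open>0 < A\<close> by (intro mult_right_mono ennreal_leI) auto
  finally show ?thesis .
next
  case False
  have p: "0 < p" using False assms by (simp add: p_def enn2real_positive_iff less_top)
  define J where "J = (\<integral>\<^sup>+ x\<in>{0<..}. ennpow (g x) p * ennreal (1 / x) \<partial>lborel)"
  define H where "H = (\<integral>\<^sup>+ x\<in>{0<..}. ennpow (h x) p * ennreal (1 / x) \<partial>lborel)"
  define r where "r = q powr p"
  have r: "0 < r" "r < 1"
    using assms p powr_less_mono2[of p q 1] by (auto simp: r_def)
  define f where "f k t = ennpow (g (R ^ k * t)) p * ennreal (1 / t) * indicator {0<..} t" for k t
  \<comment> \<open>The power of 0 is 0, so the indicator can be taken out of the power.\<close>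
  have gp: "(\<lambda>x. ennpow (g x) p * indicator {0<..} x) \<in> borel_measurable borel"
  proof -
    have "(\<lambda>x. ennpow (g x * indicator {0<..} x) p) \<in> borel_measurable borel"
      using meas by measurable
    also have "(\<lambda>x. ennpow (g x * indicator {0<..} x) p) = (\<lambda>x. ennpow (g x) p * indicator {0<..} x)"
      using p by (auto simp: ennpow_def split: split_indicator)
    finally show ?thesis .
  qed
  have f_meas: "f k \<in> borel_measurable lborel" for k
  proof -
    define gg where "gg x = ennpow (g x) p * indicator {0<..} x" for x
    have [measurable]: "gg \<in> borel_measurable borel" using gp by (simp add: gg_def[abs_def])
    have "(\<lambda>t. gg (R ^ k * t) * ennreal (1 / t) * indicator {0<..} t) \<in> borel_measurable lborel"
      by measurable
    also have "(\<lambda>t. gg (R ^ k * t) * ennreal (1 / t) * indicator {0<..} t) = f k"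
      using assms by (auto simp: gg_def f_def split: split_indicator)
    finally show ?thesis .
  qed
  have f_int: "(\<integral>\<^sup>+ t. f k t \<partial>lborel) = J" for k
    unfolding f_def J_def using nn_integral_dilation_invariant[OF _ gp, of "R ^ k"] assms by simp
  have "H \<le> (\<integral>\<^sup>+ t. (\<Sum>k. ennreal (A powr p * r ^ k) * f k t) \<partial>lborel)"
    unfolding H_def
  proof (rule nn_integral_mono)
    fix t :: real
    show "ennpow (h t) p * ennreal (1 / t) * indicator {0<..} t
      \<le> (\<Sum>k. ennreal (A powr p * r ^ k) * f k t)"
    proof (cases "0 < t")
      case True
      have "ennpow (h t) p \<le> ennpow (ennreal A * (SUP k. ennreal (q ^ k) * g (R ^ k * t))) p"
        using h[OF True] p by (intro ennpow_mono) auto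
      also have "\<dots> \<le> ennreal (A powr p) * (\<Sum>k. ennpow (ennreal (q ^ k) * g (R ^ k * t)) p)"
        using ennpow_SUP_le_suminf[OF p] p \<open>0 < A\<close>
        by (simp add: ennpow_mult[of p "ennreal A"] ennpow_ennreal mult_left_mono)
      also have "\<dots> = (\<Sum>k. ennreal (A powr p * r ^ k) * ennpow (g (R ^ k * t)) p)"
      proof -
        have "(q ^ k) powr p = r ^ k" for k
          using assms by (simp add: r_def powr_powr powr_power mult.commute flip: powr_realpow)
        then show ?thesis
          using p assms r
          by (subst ennreal_suminf_cmult[symmetric])
             (simp add: ennpow_mult ennpow_ennreal ennreal_mult mult.assoc)
      qed
      finally have "ennpow (h t) p * ennreal (1 / t) \<le>
          (\<Sum>k. ennreal (A powr p * r ^ k) * ennpow (g (R ^ k * t)) p) * ennreal (1 / t)"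
        by (rule mult_right_mono) simp
      then show ?thesis
        using True by (simp add: f_def mult.assoc flip: ennreal_suminf_multc)
    qed simp
  qed
  also have "\<dots> = (\<Sum>k. \<integral>\<^sup>+ t. ennreal (A powr p * r ^ k) * f k t \<partial>lborel)"
    by (intro nn_integral_suminf borel_measurable_times_ennreal f_meas) simp
  also have "\<dots> = (\<Sum>k. ennreal (A powr p * r ^ k) * J)"
    using f_meas by (simp add: nn_integral_cmult f_int)
  also have "\<dots> = (\<Sum>k. ennreal (A powr p * r ^ k)) * J"
    by (rule ennreal_suminf_multc)
  also have "(\<Sum>k. ennreal (A powr p * r ^ k)) = ennreal (A powr p * (1 / (1 - r)))"
    using r by (intro suminf_ennreal_eq sums_mult geometric_sums) auto
  finally have "H \<le> ennreal (A powr p * (1 / (1 - r))) * J" .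
  from ennpow_mono[OF this, of "1 / p"]
  have "ennpow H (1 / p) \<le> ennreal ((A powr p * (1 / (1 - r))) powr (1 / p)) * ennpow J (1 / p)"
    using p r by (simp add: ennpow_mult ennpow_ennreal)
  also have "(A powr p * (1 / (1 - r))) powr (1 / p) = (1 / (1 - r)) powr (1 / p) * A"
    using p assms r by (simp add: powr_mult powr_powr powr_divide)
  finally have "ennpow H (1 / p) \<le> ennreal ((1 / (1 - r)) powr (1 / p) * A) * ennpow J (1 / p)" .
  also have "\<dots> \<le> ennreal ((1 + (1 / (1 - r)) powr (1 / p)) * A) * ennpow J (1 / p)"
    using \<open>0 < A\<close> by (intro mult_right_mono ennreal_leI) auto
  finally show ?thesis
    using False by (simp add: Lmu_norm_def H_def J_def p_def r_def)
qed

text \<open>For finite \<mu> this is the integral of \<open>x powr (\<xi> * p - 1)\<close> over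
  [0, N], which converges at 0 because \<xi> p > 0. For \<mu> = \<infinity> the power in the
  constant is \<open>0 powr 0\<close>, which is 0, and the summand 1 carries the bound.\<close>

lemma Lmu_norm_powr_indicator_le:
  assumes "0 < \<mu>" "0 < \<xi>" "0 \<le> N" "0 \<le> a"
    and g: "\<And>t. 0 < t \<Longrightarrow> g t \<le> ennreal (a * t powr \<xi>) * indicator {..<N} t"
  shows "Lmu_norm \<mu> g \<le> ennreal ((1 + (1 / (\<xi> * enn2real \<mu>)) powr (1 / enn2real \<mu>)) * (a * N powr \<xi>))"
proof (cases "\<mu> = \<infinity>")
  case True
  have "g t \<le> ennreal (a * N powr \<xi>)" if "0 < t" for t
  proof -
    have "ennreal (a * t powr \<xi>) * indicator {..<N} t \<le> ennreal (a * N powr \<xi>)"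
      using assms that by (auto intro!: ennreal_leI mult_left_mono powr_mono2 split: split_indicator)
    then show ?thesis using g[OF that] by (rule order_trans[rotated])
  qed
  then show ?thesis
    using True by (auto simp: Lmu_norm_def intro: SUP_least)
next
  case False
  define p where "p = enn2real \<mu>"
  have p: "0 < p" using False assms by (simp add: p_def enn2real_positive_iff less_top)
  have xp: "0 < \<xi> * p" using p assms by simp
  have hi: "((\<lambda>x. x powr (\<xi> * p - 1)) has_integral (N powr (\<xi> * p) / (\<xi> * p))) {0..N}"
    using has_integral_powr_from_0[of "\<xi> * p - 1" N] xp assms by simp
  have "(\<integral>\<^sup>+ x\<in>{0<..}. ennpow (g x) p * ennreal (1 / x) \<partial>lborel)
      \<le> (\<integral>\<^sup>+ x. ennreal (a powr p) * ennreal (indicator {0..N} x * x powr (\<xi> * p - 1)) \<partial>lborel)"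
  proof (rule nn_integral_mono)
    fix x :: real
    show "ennpow (g x) p * ennreal (1 / x) * indicator {0<..} x
        \<le> ennreal (a powr p) * ennreal (indicator {0..N} x * x powr (\<xi> * p - 1))"
    proof (cases "0 < x")
      case x: True
      show ?thesis
      proof (cases "x < N")
        case True
        have "ennpow (g x) p \<le> ennpow (ennreal (a * x powr \<xi>)) p"
          using g[OF x] True p by (intro ennpow_mono) auto
        also have "\<dots> = ennreal (a powr p * x powr (\<xi> * p))"
          using x assms by (simp add: ennpow_ennreal powr_mult powr_powr)
        finally have "ennpow (g x) p * ennreal (1 / x) \<le> ennreal (a powr p * x powr (\<xi> * p)) * ennreal (1 / x)"
          by (rule mult_right_mono) simp
        also have "\<dots> = ennreal (a powr p) * ennreal (x powr (\<xi> * p - 1))"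
          using x by (simp add: powr_diff flip: ennreal_mult)
        finally show ?thesis using x True by simp
      next
        case False
        then have "g x = 0" using g[OF x] by simp
        then show ?thesis using p by (simp add: ennpow_def)
      qed
    qed simp
  qed
  also have "\<dots> = ennreal (a powr p) * ennreal (N powr (\<xi> * p) / (\<xi> * p))"
    using nn_integral_has_integral_lebesgue[OF _ hi]
    by (subst nn_integral_cmult) (auto simp: mult.commute)
  also have "\<dots> = ennreal (a powr p * (N powr (\<xi> * p) / (\<xi> * p)))"
    using xp by (intro ennreal_mult[symmetric]) auto
  finally have le: "(\<integral>\<^sup>+ x\<in>{0<..}. ennpow (g x) p * ennreal (1 / x) \<partial>lborel)
    \<le> ennreal (a powr p * (N powr (\<xi> * p) / (\<xi> * p)))" .
  have "Lmu_norm \<mu> g \<le> ennreal ((a powr p * (N powr (\<xi> * p) / (\<xi> * p))) powr (1 / p))"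
    using ennpow_mono[OF le, of "1 / p"] False xp p
    by (simp add: Lmu_norm_def p_def[symmetric] ennpow_ennreal)
  also have "(a powr p * (N powr (\<xi> * p) / (\<xi> * p))) powr (1 / p) =
      (1 / (\<xi> * p)) powr (1 / p) * (a * N powr \<xi>)"
    using p xp assms by (simp add: powr_mult powr_divide powr_powr)
  also have "\<dots> \<le> (1 + (1 / (\<xi> * p)) powr (1 / p)) * (a * N powr \<xi>)"
    using assms by (intro mult_right_mono) auto
  finally show ?thesis
    by (simp add: p_def ennreal_leI)
qed

section \<open>The non-increasing rearrangement\<close>

lemma antimono_rearr: "antimono (rearr \<nu> s)"
  unfolding rearr_def
  by (intro antimonoI INF_superset_mono) (auto intro: order_trans ennreal_leI)

text \<open>Every number above r dominates an admissible level. The set where |s| > r is the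
  increasing union of the sets where |s| > r + 1/(n+1), and continuity from below carries the bound
  to r itself. This includes r = 0, which is not among the levels in the infimum.\<close>

lemma emeasure_greater_rearr_le:
  assumes "sets \<nu> = UNIV" "rearr \<nu> s t = ennreal r" "0 \<le> r"
  shows "emeasure \<nu> {I. r < cmod (s I)} \<le> ennreal t"
proof -
  define A where "A n = {I. r + inverse (real (Suc n)) < cmod (s I)}" for n
  have "emeasure \<nu> (A n) \<le> ennreal t" for n
  proof -
    have "rearr \<nu> s t < ennreal (r + inverse (real (Suc n)))"
      using assms by (simp add: ennreal_less_iff)
    then obtain l where l: "0 < l" "emeasure \<nu> {I. l < cmod (s I)} \<le> ennreal t"
        "ennreal l < ennreal (r + inverse (real (Suc n)))"
      by (auto simp: rearr_def INF_less_iff)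
    then have "A n \<subseteq> {I. l < cmod (s I)}"
      by (auto simp: A_def ennreal_less_iff)
    then have "emeasure \<nu> (A n) \<le> emeasure \<nu> {I. l < cmod (s I)}"
      using assms by (intro emeasure_mono) auto
    then show ?thesis using l by simp
  qed
  then have le: "(SUP n. emeasure \<nu> (A n)) \<le> ennreal t"
    by (rule SUP_least)
  have "incseq A"
    unfolding incseq_Suc_iff
  proof (rule allI)
    fix n
    have "inverse (real (Suc (Suc n))) \<le> inverse (real (Suc n))"
      by (intro le_imp_inverse_le) auto
    then show "A n \<subseteq> A (Suc n)" unfolding A_def by (intro Collect_mono impI) linarith
  qed
  then have "(SUP n. emeasure \<nu> (A n)) = emeasure \<nu> (\<Union>n. A n)"
    using assms by (intro SUP_emeasure_incseq) auto
  also have "(\<Union>n. A n) = {I. r < cmod (s I)}"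
  proof -
    have "\<exists>n. r + inverse (real (Suc n)) < c" if "r < c" for c
      using reals_Archimedean[of "c - r"] that by (auto simp: algebra_simps)
    moreover have "r < c" if "r + inverse (real (Suc n)) < c" for n c
      using that by (rule less_trans[rotated]) simp
    ultimately show ?thesis by (fastforce simp: A_def)
  qed
  finally show ?thesis using le by simp
qed

text \<open>No entry exceeds 1, so the level 1 is always admissible; once t reaches the measure of
  \<Gamma>, every positive level is admissible and the infimum is 0.\<close>

lemma rearr_restr_one_le:
  assumes "emeasure \<nu> \<Gamma> < \<infinity>" "sets \<nu> = UNIV"
  shows "rearr \<nu> (restr \<Gamma> (\<lambda>I. 1)) t \<le> indicator {..<measure \<nu> \<Gamma>} t"
proof (cases "t < measure \<nu> \<Gamma>")
  case True
  have "{I. 1 < cmod (restr \<Gamma> (\<lambda>I. 1) I)} = {}"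
    by (auto simp: restr_def)
  then have "rearr \<nu> (restr \<Gamma> (\<lambda>I. 1)) t \<le> ennreal 1"
    unfolding rearr_def by (intro INF_lower) simp
  with True show ?thesis by simp
next
  case False
  have le: "rearr \<nu> (restr \<Gamma> (\<lambda>I. 1)) t \<le> ennreal l" if "0 < l" for l
  proof -
    have "emeasure \<nu> {I. l < cmod (restr \<Gamma> (\<lambda>I. 1) I)} \<le> emeasure \<nu> \<Gamma>"
      using assms that by (intro emeasure_mono) (auto simp: restr_def split: if_splits)
    also have "\<dots> = ennreal (measure \<nu> \<Gamma>)"
      using assms by (simp add: emeasure_eq_ennreal_measure less_top)
    also have "\<dots> \<le> ennreal t" using False by (simp add: ennreal_leI)
    finally show ?thesis
      using that unfolding rearr_def by (intro INF_lower) simp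
  qed
  have "rearr \<nu> (restr \<Gamma> (\<lambda>I. 1)) t \<le> 0"
  proof (rule ennreal_le_epsilon)
    fix e :: real assume "0 < e"
    then show "rearr \<nu> (restr \<Gamma> (\<lambda>I. 1)) t \<le> 0 + ennreal e"
      using le by simp
  qed
  then show ?thesis by simp
qed

section \<open>The function classes \<open>W_class\<close> and \<open>W_plus\<close>\<close>

lemma W_class_mono: "\<eta> \<in> W_class \<Longrightarrow> 0 \<le> x \<Longrightarrow> x \<le> y \<Longrightarrow> \<eta> x \<le> \<eta> y"
  by (auto simp: W_class_def mono_on_def)

lemma W_class_nonneg: "\<eta> \<in> W_class \<Longrightarrow> 0 \<le> x \<Longrightarrow> 0 \<le> \<eta> x"
  by (auto simp: W_class_def)

text \<open>The doubling condition is iterated m times. The dilation ratio used later is a power of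
  2 for the sake of this estimate.\<close>

lemma W_class_dyadic_doubling:
  assumes "\<eta> \<in> W_class"
  shows "\<exists>D>0. \<forall>t>0. \<eta> (2 ^ m * t) \<le> D * \<eta> t"
proof -
  obtain C where C: "0 < C" "\<And>t. 0 < t \<Longrightarrow> \<eta> (2 * t) \<le> C * \<eta> t"
    using assms by (auto simp: W_class_def)
  have "\<eta> (2 ^ m * t) \<le> C ^ m * \<eta> t" if "0 < t" for t
  proof (induction m)
    case (Suc m)
    have "\<eta> (2 ^ Suc m * t) \<le> C * \<eta> (2 ^ m * t)"
      using C(2)[of "2 ^ m * t"] that by (simp add: mult.assoc)
    also have "\<dots> \<le> C * (C ^ m * \<eta> t)"
      using Suc C by (intro mult_left_mono) auto
    finally show ?case by (simp add: mult.assoc)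
  qed simp
  then show ?thesis using C by (intro exI[of _ "C ^ m"]) auto
qed

text \<open>A zero at t would spread by doubling to all points \<open>2 ^ m * t\<close>, against the
  divergence of \<eta> at infinity.\<close>

lemma W_class_pos:
  assumes "\<eta> \<in> W_class" "0 < t"
  shows "0 < \<eta> t"
proof (rule ccontr)
  assume "\<not> 0 < \<eta> t"
  then have "\<eta> t = 0" using W_class_nonneg[of \<eta> t] assms by simp
  have le0: "\<eta> (2 ^ m * t) \<le> 0" for m
    using W_class_dyadic_doubling[OF assms(1), of m] \<open>\<eta> t = 0\<close> assms(2) by force
  have "eventually (\<lambda>x. 1 \<le> \<eta> x) at_top"
    using assms(1) by (simp add: W_class_def filterlim_at_top)
  then obtain X where X: "\<And>x. X \<le> x \<Longrightarrow> 1 \<le> \<eta> x"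
    by (auto simp: eventually_at_top_linorder)
  obtain m where "X / t < 2 ^ m"
    using real_arch_pow[of 2 "X / t"] by auto
  then have "X \<le> 2 ^ m * t"
    using assms(2) by (simp add: field_simps)
  from X[OF this] le0[of m] show False by simp
qed

lemma W_plus_imp_W_class: "\<eta> \<in> W_plus \<Longrightarrow> \<eta> \<in> W_class"
  by (simp add: W_plus_def)

text \<open>The condition on \<open>M_fun\<close> gives \<eta>(d t) \<le> r \<eta>(t) with r < 1,
  and iterating it makes the factor as small as desired.\<close>

lemma W_plus_contraction:
  assumes "\<eta> \<in> W_plus" "0 < \<epsilon>"
  obtains \<delta> where "0 < \<delta>" "\<delta> < 1" "\<And>t. 0 \<le> t \<Longrightarrow> \<eta> (\<delta> * t) \<le> \<epsilon> * \<eta> t"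
proof -
  note W = W_plus_imp_W_class[OF assms(1)]
  obtain d where d: "0 < d" "d < 1" "M_fun \<eta> d < 1"
    using assms(1) by (auto simp: W_plus_def)
  define r where "r = enn2real (M_fun \<eta> d)"
  have M: "M_fun \<eta> d = ennreal r"
    using d by (cases "M_fun \<eta> d") (auto simp: r_def)
  have r0: "0 \<le> r" by (simp add: r_def)
  have r: "0 \<le> r" "r < 1"
    using d M r0 by (auto simp: ennreal_less_one_iff)
  have step: "\<eta> (d * t) \<le> r * \<eta> t" if "0 \<le> t" for t
  proof (cases "t = 0")
    case False
    then have "0 < t" using that by simp
    then have "ennreal (\<eta> (d * t) / \<eta> t) \<le> ennreal r"
      unfolding M[symmetric] M_fun_def by (intro SUP_upper) simp
    then show ?thesis
      using r W_class_pos[OF W \<open>0 < t\<close>] by (simp add: divide_le_eq)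
  qed (use W in \<open>simp add: W_class_def\<close>)
  have iter: "\<eta> (d ^ n * t) \<le> r ^ n * \<eta> t" if "0 \<le> t" for n t
  proof (induction n)
    case (Suc n)
    have "\<eta> (d ^ Suc n * t) \<le> r * \<eta> (d ^ n * t)"
      using step[of "d ^ n * t"] that d by (simp add: mult.assoc)
    also have "\<dots> \<le> r * (r ^ n * \<eta> t)"
      using Suc r by (intro mult_left_mono) auto
    finally show ?case by (simp add: mult.assoc)
  qed simp
  obtain n where n: "r ^ n < \<epsilon>"
    using real_arch_pow_inv[OF assms(2) r(2)] by auto
  show ?thesis
  \<comment> \<open>The exponent n may be 0 when \<epsilon> > 1; \<open>Suc n\<close> keeps \<delta>
    below 1.\<close>
  proof (rule that[of "d ^ Suc n"])
    show "\<eta> (d ^ Suc n * t) \<le> \<epsilon> * \<eta> t" if "0 \<le> t" for t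
    proof -
      have "r ^ Suc n \<le> r ^ n"
        using r by (intro power_decreasing) auto
      then have "r ^ Suc n * \<eta> t \<le> \<epsilon> * \<eta> t"
        using n W_class_nonneg[OF W that] by (intro mult_right_mono) auto
      then show ?thesis using iter[OF that, of "Suc n"] by linarith
    qed
    show "d ^ Suc n < 1"
      using d by (intro power_Suc_less_one) auto
  qed (use d in auto)
qed

section \<open>Convergence of series in a quasi-Banach lattice\<close>

context standard_scheme
begin

lemma norm_minus_commute: "(\<lambda>I. s I - t I) \<in> F \<Longrightarrow> nF (\<lambda>I. t I - s I) = nF (\<lambda>I. s I - t I)"
  using norm_scale[of "\<lambda>I. s I - t I" "-1"] by simp

lemma diff_mem: "s \<in> F \<Longrightarrow> t \<in> F \<Longrightarrow> (\<lambda>I. s I - t I) \<in> F"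
  using add_mem[OF _ scale_mem[of t "-1"], of s] by simp

text \<open>The induction peels off the first term. The shifted sequence satisfies the hypothesis
  with B / (2K), so the remaining sum is bounded by B, and K (B + B) = 2 K B restores the same
  bound. The constant therefore does not grow with n.\<close>

lemma norm_sum_le:
  assumes K: "1 \<le> K" "\<And>s t. s \<in> F \<Longrightarrow> t \<in> F \<Longrightarrow> nF (\<lambda>I. s I + t I) \<le> K * (nF s + nF t)"
    and x: "\<And>k. x k \<in> F" and B: "\<And>k. (2 * K) ^ k * nF (x k) \<le> B"
  shows "(\<lambda>I. \<Sum>k<n. x k I) \<in> F \<and> nF (\<lambda>I. \<Sum>k<n. x k I) \<le> 2 * K * B"
  using x B
proof (induction n arbitrary: x B)
  case 0
  have "0 \<le> B" using 0(2)[of 0] norm_nonneg[OF 0(1), of 0] by simp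
  moreover have "nF (\<lambda>I. 0) = 0" using norm_eq_zero[OF zero_mem] by simp
  ultimately show ?case using zero_mem K by simp
next
  case (Suc n)
  let ?y = "\<lambda>I. \<Sum>k<n. x (Suc k) I"
  have "(2 * K) ^ k * nF (x (Suc k)) \<le> B / (2 * K)" for k
    using Suc.prems(2)[of "Suc k"] K by (simp add: field_simps)
  with Suc.IH[of "\<lambda>k. x (Suc k)" "B / (2 * K)"] Suc.prems(1)
  have y: "?y \<in> F" "nF ?y \<le> B"
    using K by auto
  have "nF (\<lambda>I. x 0 I + ?y I) \<le> K * (nF (x 0) + nF ?y)"
    using K y Suc.prems by blast
  also have "\<dots> \<le> K * (B + B)"
    using Suc.prems(2)[of 0] y K by (intro mult_left_mono add_mono) auto
  finally have "nF (\<lambda>I. x 0 I + ?y I) \<le> 2 * K * B" by simp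
  then show ?case
    using add_mem[OF Suc.prems(1)[of 0] y(1)] by (simp add: sum.lessThan_Suc_shift del: sum.lessThan_Suc)
qed

text \<open>Blocks of the series are bounded by the previous lemma applied to the shifted sequence,
  so the partial sums are Cauchy. Completeness gives a limit in \<open>F\<close>, and the embedding
  into the space of sequences identifies it with the coordinatewise limit \<open>s\<close>.\<close>

lemma series_mem_norm_le:
  assumes K: "1 \<le> K" "\<And>s t. s \<in> F \<Longrightarrow> t \<in> F \<Longrightarrow> nF (\<lambda>I. s I + t I) \<le> K * (nF s + nF t)"
    and x: "\<And>k. x k \<in> F" and B: "\<And>k. (2 * K) ^ k * nF (x k) \<le> B"
    and lim: "\<And>I. (\<lambda>n. \<Sum>k<n. x k I) \<longlonglongrightarrow> s I"
  shows "s \<in> F \<and> nF s \<le> 2 * K\<^sup>2 * B"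
proof -
  define S where "S n = (\<lambda>I. \<Sum>k<n. x k I)" for n
  have S: "S n \<in> F" "nF (S n) \<le> 2 * K * B" for n
    unfolding S_def using norm_sum_le[of K x B] K x B by auto
  have B0: "0 \<le> B" using B[of 0] norm_nonneg[OF x, of 0] by simp
  have tail: "nF (\<lambda>I. S n I - S m I) \<le> 2 * K * B * (1 / (2 * K)) ^ m" if mn: "m \<le> n" for m n
  proof -
    obtain d where n: "n = m + d" using mn le_Suc_ex by blast
    have "(\<Sum>k<m + d. x k I) - (\<Sum>k<m. x k I) = (\<Sum>k<d. x (m + k) I)" for I
      by (induction d) (auto simp: algebra_simps)
    then have eq: "(\<lambda>I. S n I - S m I) = (\<lambda>I. \<Sum>k<d. x (m + k) I)"
      by (simp add: S_def n)
    have "(2 * K) ^ k * nF (x (m + k)) \<le> B * (1 / (2 * K)) ^ m" for k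
      using B[of "m + k"] K by (simp add: power_add field_simps)
    then have "nF (\<lambda>I. \<Sum>k<d. x (m + k) I) \<le> 2 * K * (B * (1 / (2 * K)) ^ m)"
      using norm_sum_le[of K "\<lambda>k. x (m + k)" "B * (1 / (2 * K)) ^ m"] K x by blast
    then show ?thesis by (simp add: eq mult.assoc)
  qed
  have "\<exists>N. \<forall>m\<ge>N. \<forall>n\<ge>N. nF (\<lambda>I. S m I - S n I) < e" if "0 < e" for e
  proof -
    have "(\<lambda>m. 2 * K * B * (1 / (2 * K)) ^ m) \<longlonglongrightarrow> 2 * K * B * 0"
      using K by (intro tendsto_intros LIMSEQ_realpow_zero) auto
    then have "eventually (\<lambda>m. 2 * K * B * (1 / (2 * K)) ^ m < e) sequentially"
      using that by (intro order_tendstoD) auto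
    then obtain N where N: "\<And>m. N \<le> m \<Longrightarrow> 2 * K * B * (1 / (2 * K)) ^ m < e"
      by (auto simp: eventually_sequentially)
    have "nF (\<lambda>I. S m I - S n I) < e" if "N \<le> m" "N \<le> n" for m n
    proof (cases "n \<le> m")
      case True
      then show ?thesis using tail[of n m] N[OF that(2)] by simp
    next
      case False
      then show ?thesis
        using tail[of m n] N[OF that(1)] norm_minus_commute[OF diff_mem[OF S(1) S(1)], of m n] by simp
    qed
    then show ?thesis by blast
  qed
  with complete[of S] S(1) obtain s' where s': "s' \<in> F" "(\<lambda>n. nF (\<lambda>I. S n I - s' I)) \<longlonglongrightarrow> 0"
    by blast
  have "(\<lambda>n. S n I) \<longlonglongrightarrow> s' I" for I
    using embedded s' S(1) unfolding embedded_in_S_def by blast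
  with lim have "s' I = s I" for I
    unfolding S_def by (metis LIMSEQ_unique)
  then have "s' = s" by auto
  \<comment> \<open>A quasi-norm need not be continuous, so the bound on \<open>S n\<close> passes
    to \<open>s\<close> through one more quasi-triangle inequality. This accounts for the second
    factor K in the result.\<close>
  have "nF s \<le> K * (nF (\<lambda>I. S n I - s I) + 2 * K * B)" for n
  proof -
    have mem: "(\<lambda>I. S n I - s I) \<in> F" "(\<lambda>I. s I - S n I) \<in> F"
      using S(1) s' \<open>s' = s\<close> diff_mem by blast+
    have "nF (\<lambda>I. (s I - S n I) + S n I) \<le> K * (nF (\<lambda>I. s I - S n I) + nF (S n))"
      using K(2) mem(2) S(1) by blast
    also have "\<dots> \<le> K * (nF (\<lambda>I. S n I - s I) + 2 * K * B)"
      using S(2)[of n] K(1) norm_minus_commute[OF mem(1)] by (intro mult_left_mono) auto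
    finally show ?thesis by simp
  qed
  moreover have "(\<lambda>n. K * (nF (\<lambda>I. S n I - s I) + 2 * K * B)) \<longlonglongrightarrow> K * (0 + 2 * K * B)"
    using s' \<open>s' = s\<close> by (intro tendsto_intros) auto
  ultimately have "nF s \<le> K * (0 + 2 * K * B)"
    by (intro LIMSEQ_le_const) auto
  then show ?thesis using s' \<open>s' = s\<close> by (simp add: power2_eq_square)
qed

section \<open>The approximation error, and Jackson's inequality from the inclusion\<close>

lemma approx_err_le:
  assumes "emeasure \<nu> \<Gamma> \<le> ennreal t" "restr (- \<Gamma>) s \<in> F"
  shows "approx_err F nF \<nu> t s \<le> ennreal (nF (restr (- \<Gamma>) s))"
proof -
  have "(\<lambda>I. s I - restr \<Gamma> s I) = restr (- \<Gamma>) s"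
    by (auto simp: restr_def)
  moreover have "restr \<Gamma> s \<in> Sigma_set \<nu> t"
    using assms by (auto simp: Sigma_set_def)
  then have "approx_err F nF \<nu> t s \<le> ext_norm F nF (\<lambda>I. s I - restr \<Gamma> s I)"
    unfolding approx_err_def by (rule INF_lower)
  ultimately show ?thesis using assms by (simp add: ext_norm_def)
qed

text \<open>An approximant supported on \<Gamma> is replaced by the restriction of \<open>s\<close>
  to \<Gamma>. The error then vanishes on \<Gamma> and is unchanged elsewhere, so by the lattice
  property its quasi-norm does not increase.\<close>

lemma approx_err_lessD:
  assumes "approx_err F nF \<nu> t s < ennreal c"
  obtains \<Gamma> where "emeasure \<nu> \<Gamma> \<le> ennreal t" "restr (- \<Gamma>) s \<in> F" "nF (restr (- \<Gamma>) s) < c"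
proof -
  from assms obtain \<Gamma> y where *: "emeasure \<nu> \<Gamma> \<le> ennreal t"
      "ext_norm F nF (\<lambda>I. s I - restr \<Gamma> y I) < ennreal c"
    by (auto simp: approx_err_def INF_less_iff Sigma_set_def)
  then have mem: "(\<lambda>I. s I - restr \<Gamma> y I) \<in> F"
    by (auto simp: ext_norm_def split: if_splits)
  with * have less: "nF (\<lambda>I. s I - restr \<Gamma> y I) < c"
    using norm_nonneg[OF mem] by (simp add: ext_norm_def ennreal_less_iff)
  have dom: "cmod (restr (- \<Gamma>) s I) \<le> cmod (s I - restr \<Gamma> y I)" for I
    by (simp add: restr_def)
  show ?thesis
    using that[OF *(1) solid_mem[OF mem dom]] norm_mono[OF mem dom] less by linarith
qed

lemma approx_err_antimono:
  assumes "t \<le> t'"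
  shows "approx_err F nF \<nu> t' s \<le> approx_err F nF \<nu> t s"
proof -
  have "x \<le> ennreal t'" if "x \<le> ennreal t" for x
    using that assms ennreal_leI order_trans by blast
  then show ?thesis
    unfolding approx_err_def by (intro INF_superset_mono) (auto simp: Sigma_set_def)
qed

text \<open>For x in [t/2, t] the error at x is at least the error at t, and
  \<open>x powr \<xi>\<close> is at least \<open>(t / 2) powr \<xi>\<close>, so the integrand has a
  constant lower bound there.\<close>

lemma approx_err_le_A_norm:
  assumes "0 < \<mu>" "0 < \<xi>" "0 < t"
  shows "approx_err F nF \<nu> t s
    \<le> ennreal (2 powr \<xi> * 2 powr (1 / enn2real \<mu>) * t powr (- \<xi>)) * A_norm F nF \<nu> \<xi> \<mu> s"
proof -
  let ?c = "2 powr (1 / enn2real \<mu>)"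
  have "ennreal ((t / 2) powr \<xi>) * approx_err F nF \<nu> t s \<le> ennreal ?c * A_norm F nF \<nu> \<xi> \<mu> s"
    unfolding A_norm_def using assms
    by (intro Lmu_norm_ge_const[where t = t] mult_mono ennreal_leI powr_mono2 approx_err_antimono) auto
  then have "ennreal ((t / 2) powr (- \<xi>)) * (ennreal ((t / 2) powr \<xi>) * approx_err F nF \<nu> t s)
      \<le> ennreal ((t / 2) powr (- \<xi>)) * (ennreal ?c * A_norm F nF \<nu> \<xi> \<mu> s)"
    by (rule mult_left_mono) simp
  moreover have "ennreal ((t / 2) powr (- \<xi>)) * ennreal ((t / 2) powr \<xi>) = 1"
    using assms by (simp add: powr_minus flip: ennreal_mult)
  moreover have "(t / 2) powr (- \<xi>) = 2 powr \<xi> * t powr (- \<xi>)"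
    using assms by (simp add: powr_minus powr_divide divide_simps)
  then have "ennreal ((t / 2) powr (- \<xi>)) * ennreal ?c = ennreal (2 powr \<xi> * ?c * t powr (- \<xi>))"
    by (simp add: ac_simps flip: ennreal_mult)
  ultimately show ?thesis
    by (simp add: mult.assoc[symmetric])
qed

lemma cont_incl_imp_jackson:
  assumes "0 < \<mu>" "0 < \<xi>" and "cont_incl X nX (A_space F nF \<nu> \<xi> \<mu>) (A_norm F nF \<nu> \<xi> \<mu>)"
  shows "jackson F nF \<nu> \<xi> X nX"
proof -
  obtain C where C: "0 < C" "\<And>s. s \<in> X \<Longrightarrow> A_norm F nF \<nu> \<xi> \<mu> s \<le> ennreal C * nX s"
    using assms by (auto simp: cont_incl_def)
  define c where "c = 2 powr \<xi> * 2 powr (1 / enn2real \<mu>)"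
  have "approx_err F nF \<nu> t s \<le> ennreal (c * C * t powr (- \<xi>)) * nX s" if "s \<in> X" "0 < t" for s t
  proof -
    have "approx_err F nF \<nu> t s \<le> ennreal (c * t powr (- \<xi>)) * A_norm F nF \<nu> \<xi> \<mu> s"
      unfolding c_def using assms that by (intro approx_err_le_A_norm)
    also have "\<dots> \<le> ennreal (c * t powr (- \<xi>)) * (ennreal C * nX s)"
      using C that by (intro mult_left_mono) auto
    also have "\<dots> = ennreal (c * C * t powr (- \<xi>)) * nX s"
      using C by (simp add: c_def ac_simps ennreal_mult)
    finally show ?thesis .
  qed
  then show ?thesis
    unfolding jackson_def using C by (intro exI[of _ "c * C"]) (auto simp: c_def)
qed

section \<open>From Jackson's inequality to the bound on indicators\<close>

lemma emeasure_zero_imp_empty: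
  assumes "emeasure \<nu> \<Gamma> = 0"
  shows "\<Gamma> = {}"
proof (rule ccontr)
  assume "\<Gamma> \<noteq> {}"
  then obtain I where "I \<in> \<Gamma>" by blast
  then have "emeasure \<nu> {I} \<le> emeasure \<nu> \<Gamma>"
    using sets_nu by (intro emeasure_mono) auto
  then show False using assms nu_pos[of I] by simp
qed

text \<open>The weight cancels and leaves the indicator of \<Gamma>, whose rearrangement vanishes
  from \<open>measure \<nu> \<Gamma>\<close> on. Below that point \<eta>(t) is at most its value at
  the measure, and only a power of t remains to be integrated.\<close>

lemma lxi_norm_indicator_le:
  assumes "0 < \<mu>" "0 < \<xi>" "\<eta> \<in> W_class" "\<And>I. 0 < u I" and \<Gamma>: "emeasure \<nu> \<Gamma> < \<infinity>"
  shows "lxi_norm u \<nu> \<mu> \<xi> \<eta> (restr \<Gamma> (\<lambda>I. of_real (1 / u I)))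
    \<le> ennreal ((1 + (1 / (\<xi> * enn2real \<mu>)) powr (1 / enn2real \<mu>))
        * (\<eta> (measure \<nu> \<Gamma>) * measure \<nu> \<Gamma> powr \<xi>))"
proof -
  have "(\<lambda>I. of_real (u I) * restr \<Gamma> (\<lambda>I. of_real (1 / u I)) I) = restr \<Gamma> (\<lambda>I. 1)"
    using assms(4) by (auto simp: restr_def fun_eq_iff less_imp_neq[THEN not_sym])
  then show ?thesis
    unfolding lxi_norm_def lw_norm_def l_norm_def
  proof (simp only:, intro Lmu_norm_powr_indicator_le assms)
    fix t :: real assume t: "0 < t"
    let ?N = "measure \<nu> \<Gamma>"
    have "ennreal (t powr \<xi> * \<eta> t) * rearr \<nu> (restr \<Gamma> (\<lambda>I. 1)) t
        \<le> ennreal (t powr \<xi> * \<eta> t) * indicator {..<?N} t"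
      using rearr_restr_one_le[OF \<Gamma> sets_nu] by (intro mult_left_mono) auto
    also have "\<dots> \<le> ennreal (\<eta> ?N * t powr \<xi>) * indicator {..<?N} t"
      using t W_class_mono[OF assms(3), of t ?N]
      by (auto split: split_indicator intro!: ennreal_leI simp: mult.commute mult_left_mono)
    finally show "ennreal (t powr \<xi> * \<eta> t) * rearr \<nu> (restr \<Gamma> (\<lambda>I. 1)) t
        \<le> ennreal (\<eta> ?N * t powr \<xi>) * indicator {..<?N} t" .
  qed (use W_class_nonneg[OF assms(3)] in auto)
qed

text \<open>Membership of the weighted indicator in \<open>F\<close> is part of the claim. Jackson's
  inequality provides it only for \<Gamma> minus a small part, so the pieces found by iteration are
  summed by completeness.\<close>

lemma jackson_imp_indicator_bound:
  assumes "0 < \<mu>" "0 < \<xi>" and eta: "\<eta> \<in> W_plus" and u: "\<And>I. 0 < u I"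
    and J: "jackson F nF \<nu> \<xi> (lxi_space u \<nu> \<mu> \<xi> \<eta>) (lxi_norm u \<nu> \<mu> \<xi> \<eta>)"
  shows "\<exists>C>0. \<forall>\<Gamma>. emeasure \<nu> \<Gamma> < \<infinity> \<longrightarrow>
    ext_norm F nF (restr \<Gamma> (\<lambda>I. of_real (1 / u I))) \<le> ennreal (C * \<eta> (measure \<nu> \<Gamma>))"
proof -
  note W = W_plus_imp_W_class[OF eta]
  let ?z = "\<lambda>I. of_real (1 / u I) :: complex"
  obtain K where K: "1 \<le> K" "\<And>s t. s \<in> F \<Longrightarrow> t \<in> F \<Longrightarrow> nF (\<lambda>I. s I + t I) \<le> K * (nF s + nF t)"
    using quasi_triangle by blast
  \<comment> \<open>The factor 1 / (2K) is the decay per step that \<open>series_mem_norm_le\<close>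
    asks for.\<close>
  obtain \<delta> where \<delta>: "0 < \<delta>" "\<delta> < 1" "\<And>t. 0 \<le> t \<Longrightarrow> \<eta> (\<delta> * t) \<le> 1 / (2 * K) * \<eta> t"
    using W_plus_contraction[OF eta, of "1 / (2 * K)"] K by auto
  obtain C where C: "0 < C" "\<And>s t. s \<in> lxi_space u \<nu> \<mu> \<xi> \<eta> \<Longrightarrow> 0 < t \<Longrightarrow>
      approx_err F nF \<nu> t s \<le> ennreal (C * t powr (- \<xi>)) * lxi_norm u \<nu> \<mu> \<xi> \<eta> s"
    using J unfolding jackson_def by blast
  define c where "c = 1 + (1 / (\<xi> * enn2real \<mu>)) powr (1 / enn2real \<mu>)"
  have c: "0 < c" by (simp add: c_def add_pos_nonneg)
  \<comment> \<open>The factor 2 makes the estimate strict where \<eta> is positive; a strict bound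
    on the infimum yields an actual set through \<open>approx_err_lessD\<close>.\<close>
  define A where "A = 2 * (C * c * \<delta> powr (- \<xi>))"
  have A: "0 < A" using C c \<delta> by (simp add: A_def)
  have nonneg: "0 \<le> \<eta> (measure \<nu> \<Gamma>)" for \<Gamma>
    using W_class_nonneg[OF W] by simp
  have "\<exists>\<Gamma>'. emeasure \<nu> \<Gamma> < \<infinity> \<longrightarrow> \<Gamma>' \<subseteq> \<Gamma> \<and> emeasure \<nu> \<Gamma>' \<le> ennreal (\<delta> * measure \<nu> \<Gamma>) \<and>
      restr (\<Gamma> - \<Gamma>') ?z \<in> F \<and> nF (restr (\<Gamma> - \<Gamma>') ?z) \<le> A * \<eta> (measure \<nu> \<Gamma>)" for \<Gamma>
  proof (cases "emeasure \<nu> \<Gamma> = 0 \<or> \<not> emeasure \<nu> \<Gamma> < \<infinity>")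
    \<comment> \<open>On a null set, which is empty, \<eta> of the measure is 0 and no strict
      estimate is possible; nothing has to be removed. Sets of infinite measure are included, where
      the implication is vacuous, so that \<open>G\<close> can be chosen on all sets.\<close>
    case True
    have "restr {} ?z = (\<lambda>I. 0)" by (simp add: restr_def)
    moreover have "nF (\<lambda>I. 0) = 0" using norm_eq_zero[OF zero_mem] by simp
    ultimately show ?thesis
      using True emeasure_zero_imp_empty[of \<Gamma>] zero_mem nonneg[of \<Gamma>] A by (intro exI[of _ "{}"]) auto
  next
    case False
    define N where "N = measure \<nu> \<Gamma>"
    have eN: "emeasure \<nu> \<Gamma> = ennreal N"
      using False by (simp add: emeasure_eq_ennreal_measure N_def less_top)
    with False have N: "0 < N"
      by (simp add: zero_less_measure_iff N_def)
    have norm: "lxi_norm u \<nu> \<mu> \<xi> \<eta> (restr \<Gamma> ?z) \<le> ennreal (c * (\<eta> N * N powr \<xi>))"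
      unfolding c_def N_def using False by (intro lxi_norm_indicator_le assms W) auto
    then have "restr \<Gamma> ?z \<in> lxi_space u \<nu> \<mu> \<xi> \<eta>"
      by (auto simp: lxi_space_def intro: le_less_trans)
    then have "approx_err F nF \<nu> (\<delta> * N) (restr \<Gamma> ?z)
        \<le> ennreal (C * (\<delta> * N) powr (- \<xi>)) * lxi_norm u \<nu> \<mu> \<xi> \<eta> (restr \<Gamma> ?z)"
      using \<delta> N by (intro C) auto
    also have "\<dots> \<le> ennreal (C * (\<delta> * N) powr (- \<xi>)) * ennreal (c * (\<eta> N * N powr \<xi>))"
      by (intro mult_left_mono norm) auto
    also have "\<dots> = ennreal (C * c * \<delta> powr (- \<xi>) * \<eta> N)"
    proof -
      have "(C * (\<delta> * N) powr (- \<xi>)) * (c * (\<eta> N * N powr \<xi>)) = C * c * \<delta> powr (- \<xi>) * \<eta> N"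
        using \<delta> N by (simp add: powr_mult powr_minus)
      then show ?thesis
        using C c nonneg[of \<Gamma>] by (subst ennreal_mult[symmetric]) (auto simp: N_def)
    qed
    also have "\<dots> < ennreal (A * \<eta> N)"
      using C c \<delta> W_class_pos[OF W N] by (simp add: A_def ennreal_less_iff)
    finally obtain \<Gamma>0 where \<Gamma>0: "emeasure \<nu> \<Gamma>0 \<le> ennreal (\<delta> * N)" "restr (- \<Gamma>0) (restr \<Gamma> ?z) \<in> F"
        "nF (restr (- \<Gamma>0) (restr \<Gamma> ?z)) < A * \<eta> N"
      by (rule approx_err_lessD)
    have eq: "restr (- \<Gamma>0) (restr \<Gamma> ?z) = restr (\<Gamma> - \<Gamma> \<inter> \<Gamma>0) ?z"
      by (auto simp: restr_def)
    have "emeasure \<nu> (\<Gamma> \<inter> \<Gamma>0) \<le> emeasure \<nu> \<Gamma>0"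
      using sets_nu by (intro emeasure_mono) auto
    with \<Gamma>0 eq show ?thesis
      by (intro exI[of _ "\<Gamma> \<inter> \<Gamma>0"]) (auto simp: N_def)
  qed
  then obtain G where G: "\<And>\<Gamma>. emeasure \<nu> \<Gamma> < \<infinity> \<Longrightarrow> G \<Gamma> \<subseteq> \<Gamma> \<and>
      emeasure \<nu> (G \<Gamma>) \<le> ennreal (\<delta> * measure \<nu> \<Gamma>) \<and>
      restr (\<Gamma> - G \<Gamma>) ?z \<in> F \<and> nF (restr (\<Gamma> - G \<Gamma>) ?z) \<le> A * \<eta> (measure \<nu> \<Gamma>)"
    by metis
  have "ext_norm F nF (restr \<Gamma> ?z) \<le> ennreal (2 * K\<^sup>2 * A * \<eta> (measure \<nu> \<Gamma>))"
    if \<Gamma>: "emeasure \<nu> \<Gamma> < \<infinity>" for \<Gamma>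
  proof -
    define H where "H k = (G ^^ k) \<Gamma>" for k
    have H_Suc: "H (Suc k) = G (H k)" and H_0: "H 0 = \<Gamma>" for k
      by (simp_all add: H_def)
    have fin: "emeasure \<nu> (H k) < \<infinity>" for k
    proof (induction k)
      case (Suc k)
      then show ?case
        using G[OF Suc] unfolding H_Suc by (auto intro: le_less_trans)
    qed (use \<Gamma> in \<open>simp add: H_0\<close>)
    have sub: "H (Suc k) \<subseteq> H k" and
      mem: "restr (H k - H (Suc k)) ?z \<in> F" and
      norm: "nF (restr (H k - H (Suc k)) ?z) \<le> A * \<eta> (measure \<nu> (H k))" for k
      using G[OF fin[of k]] by (auto simp: H_Suc)
    have decr: "measure \<nu> (H (Suc k)) \<le> \<delta> * measure \<nu> (H k)" for k
    proof -
      have "emeasure \<nu> (H (Suc k)) \<le> ennreal (\<delta> * measure \<nu> (H k))"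
        using G[OF fin[of k]] by (simp add: H_Suc)
      then show ?thesis
        using fin[of "Suc k"] \<delta> by (simp add: emeasure_eq_ennreal_measure less_top)
    qed
    have eta_decr: "(2 * K) ^ k * \<eta> (measure \<nu> (H k)) \<le> \<eta> (measure \<nu> \<Gamma>)" for k
    proof (induction k)
      case (Suc k)
      have "\<eta> (measure \<nu> (H (Suc k))) \<le> \<eta> (\<delta> * measure \<nu> (H k))"
        by (rule W_class_mono[OF W _ decr]) simp
      also have "\<dots> \<le> 1 / (2 * K) * \<eta> (measure \<nu> (H k))"
        by (rule \<delta>(3)) simp
      finally have "(2 * K) * \<eta> (measure \<nu> (H (Suc k))) \<le> \<eta> (measure \<nu> (H k))"
        using K by (simp add: field_simps)
      then have "(2 * K) ^ k * ((2 * K) * \<eta> (measure \<nu> (H (Suc k)))) \<le> (2 * K) ^ k * \<eta> (measure \<nu> (H k))"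
        using K by (intro mult_left_mono) auto
      then show ?case using Suc by (simp add: ac_simps)
    qed (simp add: H_0)
    have meas_decr: "measure \<nu> (H k) \<le> \<delta> ^ k * measure \<nu> \<Gamma>" for k
    proof (induction k)
      case (Suc k)
      then have "\<delta> * measure \<nu> (H k) \<le> \<delta> * (\<delta> ^ k * measure \<nu> \<Gamma>)"
        using \<delta> by (intro mult_left_mono) auto
      then show ?case using decr[of k] by simp
    qed (simp add: H_0)
    \<comment> \<open>The differences of the decreasing sets \<open>H k\<close> telescope.\<close>
    have partial: "(\<Sum>k<n. restr (H k - H (Suc k)) ?z I) = restr (\<Gamma> - H n) ?z I" for n I
    proof (induction n)
      case (Suc n)
      have "H n \<subseteq> \<Gamma>"
        by (induction n) (use sub in \<open>auto simp: H_0\<close>)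
      with sub[of n] Suc show ?case by (auto simp: restr_def)
    qed (simp add: H_0 restr_def)
    have "(\<lambda>n. \<Sum>k<n. restr (H k - H (Suc k)) ?z I) \<longlonglongrightarrow> restr \<Gamma> ?z I" for I
    proof -
      have "(\<lambda>n. \<delta> ^ n * measure \<nu> \<Gamma>) \<longlonglongrightarrow> 0 * measure \<nu> \<Gamma>"
        using \<delta> by (intro tendsto_intros LIMSEQ_realpow_zero) auto
      \<comment> \<open>As a subset of \<Gamma> the point has finite measure, so
        \<open>measure\<close> does not take its default value 0 there.\<close>
      moreover have "0 < measure \<nu> {I}" if "I \<in> \<Gamma>"
      proof -
        have "emeasure \<nu> {I} \<le> emeasure \<nu> \<Gamma>"
          using that sets_nu by (intro emeasure_mono) auto
        then show ?thesis
          using \<Gamma> nu_pos[of I] by (simp add: measure_def enn2real_positive_iff)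
      qed
      ultimately have "eventually (\<lambda>n. I \<in> \<Gamma> \<longrightarrow> \<delta> ^ n * measure \<nu> \<Gamma> < measure \<nu> {I}) sequentially"
        by (cases "I \<in> \<Gamma>") (auto dest: order_tendstoD(2))
      \<comment> \<open>A point cannot lie in a set of smaller measure than its own. Hence I has
        left \<open>H n\<close> for large n, and the partial sums at I are eventually
        constant.\<close>
      then have "eventually (\<lambda>n. restr (\<Gamma> - H n) ?z I = restr \<Gamma> ?z I) sequentially"
      proof (rule eventually_mono)
        fix n assume n: "I \<in> \<Gamma> \<longrightarrow> \<delta> ^ n * measure \<nu> \<Gamma> < measure \<nu> {I}"
        have "measure \<nu> {I} \<le> measure \<nu> (H n)" if "I \<in> H n"
          using that fin[of n] sets_nu by (intro measure_mono_fmeasurable fmeasurableI) auto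
        then have "I \<notin> H n" if "I \<in> \<Gamma>"
          using n meas_decr[of n] that by force
        then show "restr (\<Gamma> - H n) ?z I = restr \<Gamma> ?z I"
          by (auto simp: restr_def)
      qed
      then show ?thesis
        unfolding partial by (rule tendsto_eventually)
    qed
    moreover have "(2 * K) ^ k * nF (restr (H k - H (Suc k)) ?z) \<le> A * \<eta> (measure \<nu> \<Gamma>)" for k
    proof -
      have "(2 * K) ^ k * nF (restr (H k - H (Suc k)) ?z) \<le> (2 * K) ^ k * (A * \<eta> (measure \<nu> (H k)))"
        using K norm by (intro mult_left_mono) auto
      also have "\<dots> = A * ((2 * K) ^ k * \<eta> (measure \<nu> (H k)))"
        by simp
      also have "\<dots> \<le> A * \<eta> (measure \<nu> \<Gamma>)"
        using A eta_decr by (intro mult_left_mono) auto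
      finally show ?thesis .
    qed
    ultimately have "restr \<Gamma> ?z \<in> F \<and> nF (restr \<Gamma> ?z) \<le> 2 * K\<^sup>2 * (A * \<eta> (measure \<nu> \<Gamma>))"
      using K mem by (intro series_mem_norm_le) auto
    then show ?thesis by (simp add: ext_norm_def ennreal_leI mult.assoc)
  qed
  then show ?thesis
    using A K by (intro exI[of _ "2 * K\<^sup>2 * A"]) auto
qed

section \<open>From the bound on indicators to the inclusion\<close>

lemma sum_restr_levels:
  fixes w :: "'i \<Rightarrow> real"
  assumes "antimono r"
  shows "(\<Sum>k<n. restr {I. r (Suc k) < w I \<and> w I \<le> r k} s I) = restr {I. r n < w I \<and> w I \<le> r 0} s I"
proof (induction n)
  case (Suc n)
  have "r (Suc n) \<le> r n" "r n \<le> r 0"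
    using assms by (auto intro: antimonoD)
  with Suc show ?case by (auto simp: restr_def)
qed (auto simp: restr_def)

text \<open>With \<open>r k\<close> the rearrangement of the weighted sequence at
  \<open>R ^ k * t\<close>, the entries above \<open>r 0\<close> occupy measure at most t and are
  the ones approximated. The others lie in levels \<open>E k\<close>, where the bound on indicators
  applies. The growth (2K)^k demanded by the series lemma becomes a power of q, since g at
  \<open>R ^ k * t\<close> carries the extra factor R^(k \<xi>).\<close>

lemma approx_err_le_SUP_rearr:
  fixes s :: "'i \<Rightarrow> complex" and u :: "'i \<Rightarrow> real" and \<xi> :: real and \<eta> :: "real \<Rightarrow> real"
  defines "g \<equiv> \<lambda>x. ennreal (x powr \<xi> * \<eta> x) * rearr \<nu> (\<lambda>I. of_real (u I) * s I) x"
  assumes K: "1 \<le> K" "\<And>s t. s \<in> F \<Longrightarrow> t \<in> F \<Longrightarrow> nF (\<lambda>I. s I + t I) \<le> K * (nF s + nF t)"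
    and W: "\<eta> \<in> W_class" and u: "\<And>I. 0 < u I"
    and C: "0 < C" "\<And>\<Gamma>. emeasure \<nu> \<Gamma> < \<infinity> \<Longrightarrow>
      ext_norm F nF (restr \<Gamma> (\<lambda>I. of_real (1 / u I))) \<le> ennreal (C * \<eta> (measure \<nu> \<Gamma>))"
    and R: "1 \<le> R" and D: "0 < D" "\<And>t. 0 < t \<Longrightarrow> \<eta> (R * t) \<le> D * \<eta> t"
    and t: "0 < t"
  shows "ennreal (t powr \<xi>) * approx_err F nF \<nu> t s
    \<le> ennreal (2 * K\<^sup>2 * C * D) * (SUP k. ennreal ((2 * K * R powr (- \<xi>)) ^ k) * g (R ^ k * t))"
proof -
  define q where "q = 2 * K * R powr (- \<xi>)"
  define w where "w I = u I * cmod (s I)" for I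
  let ?us = "\<lambda>I. of_real (u I) * s I"
  let ?z = "\<lambda>I. of_real (1 / u I) :: complex"
  have w: "cmod (?us I) = w I" for I
    using u[of I] by (simp add: w_def norm_mult)
  have q: "0 < q" using K R by (simp add: q_def)
  have Rk: "0 < R ^ k * t" for k using R t by simp
  have eta_pos: "0 < \<eta> (R ^ k * t)" for k by (rule W_class_pos[OF W Rk])
  have A: "0 < 2 * K\<^sup>2 * C * D" using K C D by simp
  define G where "G = (SUP k. ennreal (q ^ k) * g (R ^ k * t))"
  have "ennreal (t powr \<xi>) * approx_err F nF \<nu> t s \<le> ennreal (2 * K\<^sup>2 * C * D) * G"
  proof (cases G)
    case top
    then show ?thesis using K(1) C(1) D(1) by (simp add: ennreal_mult_top)
  next
    case (real b)
    define h where "h k = q ^ k * ((R ^ k * t) powr \<xi> * \<eta> (R ^ k * t))" for k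
    have h_pos: "0 < h k" for k
      unfolding h_def using q eta_pos[of k] R t by (intro mult_pos_pos) auto
    have h_le: "ennreal (h k) * rearr \<nu> ?us (R ^ k * t) \<le> ennreal b" for k
    proof -
      have "ennreal (h k) * rearr \<nu> ?us (R ^ k * t) = ennreal (q ^ k) * g (R ^ k * t)"
        using q eta_pos[of k] by (simp add: h_def g_def ennreal_mult mult.assoc)
      also have "\<dots> \<le> G" unfolding G_def by (rule SUP_upper) simp
      finally show ?thesis using real by simp
    qed
    define r where "r k = enn2real (rearr \<nu> ?us (R ^ k * t))" for k
    \<comment> \<open>A positive multiple of this value is at most the finite number b, so the value
      is finite.\<close>
    have r: "rearr \<nu> ?us (R ^ k * t) = ennreal (r k)" for k
    proof (cases "rearr \<nu> ?us (R ^ k * t)")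
      case top
      with h_le[of k] h_pos[of k] show ?thesis by (simp add: ennreal_mult_top top_unique)
    qed (simp add: r_def)
    have r0: "0 \<le> r k" for k by (simp add: r_def)
    \<comment> \<open>The powers of R in q^k and in the weight cancel, leaving the growth that the
      series lemma requires.\<close>
    have h_eq: "h k = (2 * K) ^ k * t powr \<xi> * \<eta> (R ^ k * t)" for k
    proof -
      have "(R powr (- \<xi>)) ^ k * (R ^ k * t) powr \<xi> = t powr \<xi>"
      proof -
        have "(R powr (- \<xi>)) ^ k = R powr (- \<xi> * real k)" "(R ^ k) powr \<xi> = R powr (\<xi> * real k)"
          using R by (simp_all add: powr_power powr_powr mult.commute flip: powr_realpow)
        then show ?thesis
          using R t by (simp add: powr_mult flip: powr_add)
      qed
      then show ?thesis by (simp add: h_def q_def power_mult_distrib)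
    qed
    have hr: "(2 * K) ^ k * t powr \<xi> * \<eta> (R ^ k * t) * r k \<le> b" for k
    proof -
      have "ennreal (h k * r k) \<le> ennreal b"
        using h_le[of k] r[of k] h_pos[of k] r0[of k] by (simp add: ennreal_mult)
      then show ?thesis using real by (simp add: h_eq)
    qed
    have anti: "antimono r"
    proof (rule antimonoI)
      fix i j :: nat assume "i \<le> j"
      then have "R ^ i * t \<le> R ^ j * t"
        using R t by (intro mult_right_mono power_increasing) auto
      then have "ennreal (r j) \<le> ennreal (r i)"
        using antimonoD[OF antimono_rearr] r by metis
      then show "r j \<le> r i" using r0 by simp
    qed
    \<comment> \<open>Because \<eta>(R^k t) \<ge> \<eta>(t) > 0, the bound \<open>hr\<close> forces
      geometric decay. Thus every nonzero entry with weighted modulus at most \<open>r 0\<close>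
      belongs to some level.\<close>
    have r_lim: "r \<longlonglongrightarrow> 0"
    proof (rule tendsto_sandwich[of "\<lambda>_. 0" _ _ "\<lambda>k. b / (t powr \<xi> * \<eta> t) * (1 / (2 * K)) ^ k"])
      have "r k \<le> b / (t powr \<xi> * \<eta> t) * (1 / (2 * K)) ^ k" for k
      proof -
        have "\<eta> t \<le> \<eta> (R ^ k * t)"
          using t R one_le_power[OF R, of k] by (intro W_class_mono[OF W]) auto
        then have "(2 * K) ^ k * t powr \<xi> * \<eta> t * r k \<le> (2 * K) ^ k * t powr \<xi> * \<eta> (R ^ k * t) * r k"
          using K r0 by (intro mult_left_mono mult_right_mono) auto
        also have "\<dots> \<le> b" by (rule hr)
        finally show ?thesis
          using K t eta_pos[of 0] by (simp add: field_simps)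
      qed
      then show "eventually (\<lambda>k. r k \<le> b / (t powr \<xi> * \<eta> t) * (1 / (2 * K)) ^ k) sequentially"
        by simp
      have "(\<lambda>k. b / (t powr \<xi> * \<eta> t) * (1 / (2 * K)) ^ k) \<longlonglongrightarrow> b / (t powr \<xi> * \<eta> t) * 0"
        using K by (intro tendsto_intros LIMSEQ_realpow_zero) auto
      then show "(\<lambda>k. b / (t powr \<xi> * \<eta> t) * (1 / (2 * K)) ^ k) \<longlonglongrightarrow> 0" by simp
    qed (use r0 in auto)
    define E where "E k = {I. r (Suc k) < w I \<and> w I \<le> r k}" for k
    have level: "emeasure \<nu> {I. r k < w I} \<le> ennreal (R ^ k * t)" for k
      using emeasure_greater_rearr_le[OF sets_nu r r0] by (simp add: w)
    \<comment> \<open>The lower end of the level is \<open>r (Suc k)\<close>, so the measure is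
      controlled by the next dilate; the extra factor R is paid for by D.\<close>
    have E_le: "emeasure \<nu> (E k) \<le> ennreal (R * (R ^ k * t))" for k
    proof -
      have "emeasure \<nu> (E k) \<le> emeasure \<nu> {I. r (Suc k) < w I}"
        using sets_nu by (intro emeasure_mono) (auto simp: E_def)
      then show ?thesis using level[of "Suc k"] by (simp add: mult.assoc)
    qed
    have E_bound: "restr (E k) s \<in> F \<and> nF (restr (E k) s) \<le> r k * (C * (D * \<eta> (R ^ k * t)))" for k
    proof -
      have fin: "emeasure \<nu> (E k) < \<infinity>"
        using E_le[of k] by (auto intro: le_less_trans)
      have ext: "ext_norm F nF (restr (E k) ?z) \<le> ennreal (C * \<eta> (measure \<nu> (E k)))"
        by (rule C(2)[OF fin])
      then have mem: "restr (E k) ?z \<in> F"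
        by (auto simp: ext_norm_def top_unique split: if_splits)
      have "nF (restr (E k) ?z) \<le> C * \<eta> (measure \<nu> (E k))"
        using ext mem C W_class_nonneg[OF W] by (simp add: ext_norm_def)
      also have "measure \<nu> (E k) \<le> R * (R ^ k * t)"
        using E_le[of k] fin R t by (simp add: emeasure_eq_ennreal_measure less_top)
      then have "C * \<eta> (measure \<nu> (E k)) \<le> C * (D * \<eta> (R ^ k * t))"
        using C W_class_mono[OF W, of "measure \<nu> (E k)" "R * (R ^ k * t)"] D(2)[OF Rk, of k]
        by (intro mult_left_mono) auto
      finally have z: "nF (restr (E k) ?z) \<le> C * (D * \<eta> (R ^ k * t))" .
      let ?y = "\<lambda>I. of_real (r k) * restr (E k) ?z I"
      have y: "?y \<in> F" "nF ?y = r k * nF (restr (E k) ?z)"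
        using scale_mem[OF mem] norm_scale[OF mem] r0 by auto
      \<comment> \<open>On \<open>E k\<close> the weighted modulus is at most \<open>r k\<close>,
        that is, |s_I| \<le> r_k / u_I.\<close>
      have dom: "cmod (restr (E k) s I) \<le> cmod (?y I)" for I
        using u[of I] r0[of k] by (auto simp: restr_def norm_mult E_def w_def norm_divide field_simps)
      have "nF (restr (E k) s) \<le> nF ?y"
        by (rule norm_mono[OF y(1) dom])
      also have "\<dots> \<le> r k * (C * (D * \<eta> (R ^ k * t)))"
        using y(2) z r0 by (simp add: mult_left_mono)
      finally show ?thesis using solid_mem[OF y(1) dom] by simp
    qed
    have "restr (- {I. r 0 < w I}) s \<in> F \<and>
        nF (restr (- {I. r 0 < w I}) s) \<le> 2 * K\<^sup>2 * (C * D * b * t powr (- \<xi>))"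
    proof (rule series_mem_norm_le[OF K, where x = "\<lambda>k. restr (E k) s"])
      fix k
      have "(2 * K) ^ k * nF (restr (E k) s) \<le> (2 * K) ^ k * (r k * (C * (D * \<eta> (R ^ k * t))))"
        using K E_bound by (intro mult_left_mono) auto
      also have "\<dots> = C * D * t powr (- \<xi>) * ((2 * K) ^ k * t powr \<xi> * \<eta> (R ^ k * t) * r k)"
        using t by (simp add: powr_minus)
      also have "\<dots> \<le> C * D * t powr (- \<xi>) * b"
        using C D hr by (intro mult_left_mono) auto
      finally show "(2 * K) ^ k * nF (restr (E k) s) \<le> C * D * b * t powr (- \<xi>)"
        by (simp add: ac_simps)
    next
      fix I
      \<comment> \<open>Entries equal to 0 lie in no level, but both sides vanish there.\<close>
      have "eventually (\<lambda>n. restr {I. r n < w I \<and> w I \<le> r 0} s I = restr (- {I. r 0 < w I}) s I) sequentially"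
      proof (cases "s I = 0")
        case False
        then have "0 < w I" using u[of I] by (simp add: w_def)
        then have "eventually (\<lambda>n. r n < w I) sequentially"
          by (rule order_tendstoD(2)[OF r_lim])
        then show ?thesis
          by (rule eventually_mono) (auto simp: restr_def)
      qed (simp add: restr_def)
      then show "(\<lambda>n. \<Sum>k<n. restr (E k) s I) \<longlonglongrightarrow> restr (- {I. r 0 < w I}) s I"
        unfolding E_def sum_restr_levels[OF anti] by (rule tendsto_eventually)
    qed (use E_bound in auto)
    moreover have "emeasure \<nu> {I. r 0 < w I} \<le> ennreal t" using level[of 0] by simp
    ultimately have "approx_err F nF \<nu> t s \<le> ennreal (2 * K\<^sup>2 * (C * D * b * t powr (- \<xi>)))"
      by (meson approx_err_le ennreal_leI order_trans)
    then have "ennreal (t powr \<xi>) * approx_err F nF \<nu> t s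
        \<le> ennreal (t powr \<xi>) * ennreal (2 * K\<^sup>2 * (C * D * b * t powr (- \<xi>)))"
      by (rule mult_left_mono) simp
    also have "\<dots> = ennreal (2 * K\<^sup>2 * C * D * b)"
      using t by (simp add: powr_minus field_simps flip: ennreal_mult')
    also have "\<dots> = ennreal (2 * K\<^sup>2 * C * D) * G"
      using A real by (simp only: ennreal_mult)
    finally show ?thesis .
  qed
  then show ?thesis by (simp add: G_def q_def)
qed

lemma indicator_bound_imp_cont_incl:
  assumes "0 < \<mu>" "0 < \<xi>" and W: "\<eta> \<in> W_class" and u: "\<And>I. 0 < u I"
    and bound: "\<exists>C>0. \<forall>\<Gamma>. emeasure \<nu> \<Gamma> < \<infinity> \<longrightarrow>
      ext_norm F nF (restr \<Gamma> (\<lambda>I. of_real (1 / u I))) \<le> ennreal (C * \<eta> (measure \<nu> \<Gamma>))"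
  shows "cont_incl (lxi_space u \<nu> \<mu> \<xi> \<eta>) (lxi_norm u \<nu> \<mu> \<xi> \<eta>)
    (A_space F nF \<nu> \<xi> \<mu>) (A_norm F nF \<nu> \<xi> \<mu>)"
proof -
  obtain K where K: "1 \<le> K" "\<And>s t. s \<in> F \<Longrightarrow> t \<in> F \<Longrightarrow> nF (\<lambda>I. s I + t I) \<le> K * (nF s + nF t)"
    using quasi_triangle by blast
  obtain C where C: "0 < C" "\<And>\<Gamma>. emeasure \<nu> \<Gamma> < \<infinity> \<Longrightarrow>
      ext_norm F nF (restr \<Gamma> (\<lambda>I. of_real (1 / u I))) \<le> ennreal (C * \<eta> (measure \<nu> \<Gamma>))"
    using bound by blast
  \<comment> \<open>With R = 2^m this choice gives q = 2 K R^(-\<xi>) < 1.\<close>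
  obtain m where m: "2 * K < (2 powr \<xi>) ^ m"
    using real_arch_pow[of "2 powr \<xi>" "2 * K"] assms by auto
  define R :: real where "R = 2 ^ m"
  have R: "1 \<le> R" by (simp add: R_def)
  obtain D where D: "0 < D" "\<And>t. 0 < t \<Longrightarrow> \<eta> (R * t) \<le> D * \<eta> t"
    using W_class_dyadic_doubling[OF W, of m] unfolding R_def by blast
  define q where "q = 2 * K * R powr (- \<xi>)"
  have "(2 powr \<xi>) ^ m = R powr \<xi>"
    by (simp add: R_def powr_power powr_powr mult.commute flip: powr_realpow)
  then have q: "0 < q" "q < 1"
    using m K R by (auto simp: q_def powr_minus field_simps)
  define A where "A = 2 * K\<^sup>2 * C * D"
  have A: "0 < A" using K C D by (simp add: A_def)
  define c where "c = 1 + (1 / (1 - q powr enn2real \<mu>)) powr (1 / enn2real \<mu>)"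
  have "0 < c" by (simp add: c_def add_pos_nonneg)
  have le: "A_norm F nF \<nu> \<xi> \<mu> s \<le> ennreal (c * A) * lxi_norm u \<nu> \<mu> \<xi> \<eta> s" for s
    unfolding A_norm_def lxi_norm_def lw_norm_def l_norm_def c_def
  proof (rule Lmu_norm_SUP_dilations)
    let ?\<rho> = "rearr \<nu> (\<lambda>I. of_real (u I) * s I)"
    have "continuous_on {0..} \<eta>"
      using W by (simp add: W_class_def)
    \<comment> \<open>Continuity of \<eta> is known on the closed half-line only; composing with
      \<open>max 0\<close> gives a Borel function on the whole line that agrees with \<eta> where
      the indicator is 1.\<close>
    then have "continuous_on UNIV (\<lambda>x. \<eta> (max 0 x))"
      by (rule continuous_on_compose2) (auto intro!: continuous_intros)
    then have [measurable]: "(\<lambda>x. \<eta> (max 0 x)) \<in> borel_measurable borel"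
      by (rule borel_measurable_continuous_onI)
    have [measurable]: "?\<rho> \<in> borel_measurable borel"
      by (rule antimono_borel_measurable_ennreal[OF antimono_rearr])
    have "(\<lambda>x. ennreal (x powr \<xi> * \<eta> (max 0 x)) * ?\<rho> x * indicator {0<..} x) \<in> borel_measurable borel"
      by measurable
    also have "(\<lambda>x. ennreal (x powr \<xi> * \<eta> (max 0 x)) * ?\<rho> x * indicator {0<..} x)
        = (\<lambda>x. ennreal (x powr \<xi> * \<eta> x) * ?\<rho> x * indicator {0<..} x)"
      by (auto simp: fun_eq_iff split: split_indicator)
    finally show "\<dots> \<in> borel_measurable borel" .
  next
    fix t :: real assume t: "0 < t"
    show "ennreal (t powr \<xi>) * approx_err F nF \<nu> t s \<le> ennreal A * (SUP k. ennreal (q ^ k) *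
        (ennreal ((R ^ k * t) powr \<xi> * \<eta> (R ^ k * t)) * rearr \<nu> (\<lambda>I. of_real (u I) * s I) (R ^ k * t)))"
      unfolding A_def q_def by (rule approx_err_le_SUP_rearr[OF K W u C R D t]; assumption)
  qed (use assms q R A in auto)
  have "lxi_space u \<nu> \<mu> \<xi> \<eta> \<subseteq> A_space F nF \<nu> \<xi> \<mu>"
  proof
    fix s assume "s \<in> lxi_space u \<nu> \<mu> \<xi> \<eta>"
    then have "ennreal (c * A) * lxi_norm u \<nu> \<mu> \<xi> \<eta> s < \<infinity>"
      by (simp add: lxi_space_def ennreal_mult_less_top)
    with le[of s] show "s \<in> A_space F nF \<nu> \<xi> \<mu>"
      unfolding A_space_def by (blast intro: le_less_trans)
  qed
  then show ?thesis
    unfolding cont_incl_def using \<open>0 < c\<close> le A by (intro conjI exI[of _ "c * A"]) auto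
qed

end

section \<open>The cycle 1) to 2) to 3) to 1)\<close>

theorem theorem2p6p1:
  fixes F :: "('i::countable \<Rightarrow> complex) set"
    and nF :: "('i \<Rightarrow> complex) \<Rightarrow> real"
    and \<nu> :: "'i measure"
    and u :: "'i \<Rightarrow> real"
    and \<xi> :: real
    and \<mu> :: ennreal
    and \<eta> :: "real \<Rightarrow> real"
  assumes "standard_scheme F nF \<nu>"
    and "\<And>I. u I > 0"
    and "\<xi> > 0"
    and "\<mu> > 0"
    and "\<eta> \<in> W_plus"
  shows "((\<exists>C::real. C > 0 \<and> (\<forall>\<Gamma>. emeasure \<nu> \<Gamma> < \<infinity> \<longrightarrow>
            ext_norm F nF (restr \<Gamma> (\<lambda>I. of_real (1 / u I))) \<le> ennreal (C * \<eta> (measure \<nu> \<Gamma>))))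
          \<longleftrightarrow> cont_incl (lxi_space u \<nu> \<mu> \<xi> \<eta>) (lxi_norm u \<nu> \<mu> \<xi> \<eta>)
                (A_space F nF \<nu> \<xi> \<mu>) (A_norm F nF \<nu> \<xi> \<mu>))
       \<and> (cont_incl (lxi_space u \<nu> \<mu> \<xi> \<eta>) (lxi_norm u \<nu> \<mu> \<xi> \<eta>)
                (A_space F nF \<nu> \<xi> \<mu>) (A_norm F nF \<nu> \<xi> \<mu>)
          \<longleftrightarrow> jackson F nF \<nu> \<xi> (lxi_space u \<nu> \<mu> \<xi> \<eta>) (lxi_norm u \<nu> \<mu> \<xi> \<eta>))"
proof -
  interpret standard_scheme F nF \<nu> by fact
  have "cont_incl (lxi_space u \<nu> \<mu> \<xi> \<eta>) (lxi_norm u \<nu> \<mu> \<xi> \<eta>)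
      (A_space F nF \<nu> \<xi> \<mu>) (A_norm F nF \<nu> \<xi> \<mu>)"
    if "\<exists>C>0. \<forall>\<Gamma>. emeasure \<nu> \<Gamma> < \<infinity> \<longrightarrow>
      ext_norm F nF (restr \<Gamma> (\<lambda>I. of_real (1 / u I))) \<le> ennreal (C * \<eta> (measure \<nu> \<Gamma>))"
    using indicator_bound_imp_cont_incl assms W_plus_imp_W_class that by blast
  moreover have "jackson F nF \<nu> \<xi> (lxi_space u \<nu> \<mu> \<xi> \<eta>) (lxi_norm u \<nu> \<mu> \<xi> \<eta>)"
    if "cont_incl (lxi_space u \<nu> \<mu> \<xi> \<eta>) (lxi_norm u \<nu> \<mu> \<xi> \<eta>)
      (A_space F nF \<nu> \<xi> \<mu>) (A_norm F nF \<nu> \<xi> \<mu>)"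
    using cont_incl_imp_jackson assms that by blast
  moreover have "\<exists>C>0. \<forall>\<Gamma>. emeasure \<nu> \<Gamma> < \<infinity> \<longrightarrow>
      ext_norm F nF (restr \<Gamma> (\<lambda>I. of_real (1 / u I))) \<le> ennreal (C * \<eta> (measure \<nu> \<Gamma>))"
    if "jackson F nF \<nu> \<xi> (lxi_space u \<nu> \<mu> \<xi> \<eta>) (lxi_norm u \<nu> \<mu> \<xi> \<eta>)"
    using jackson_imp_indicator_bound assms that by blast
  ultimately show ?thesis by blast
qed

end
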